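(* Let $1\le m_j<n_j$ be integer sequences such that $m_j\to\infty$ and $n_j/m_j\to\lambda$ for some real $\lambda>1$, and put $$\lambda_*:=\min_{\pi/4<x<\pi/2}\frac{\log\sin(x-\pi/4)}{\log\sin x}.$$ Then the minimum is attained and $$\Phi_\chi(\lambda)>\frac\pi4\quad\Longleftrightarrow\quad\lambda>\lambda_*.$$ Consequently, if $\lambda>\lambda_*$, then $$\liminf_{j\to\infty}\left(d_{\mathrm{GH}}(\mathbb S^{m_j},\mathbb S^{n_j})-\frac12c_{m_j,n_j}\right)>0,$$ and hence $\tfrac12c_{m_j,n_j}<d_{\mathrm{GH}}(\mathbb S^{m_j},\mathbb S^{n_j})$ for all sufficiently large $j$. In particular, if $\lambda\ge9$, then $$\liminf_{j\to\infty}\left(d_{\mathrm{GH}}(\mathbb S^{m_j},\mathbb S^{n_j})-\frac12c_{m_j,n_j}\right)\ge\frac\pi{20}-\arcsin\left(\frac{38+17\sqrt5}{512}\right)>0.$$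
   Context: For $m\ge1$, $\mathbb S^m\subset\mathbb R^{m+1}$ is the unit round sphere with geodesic metric $\arccos\langle x,x'\rangle$; $\mathbb S^0$ is two points at distance $\pi$. $d_{\mathrm{GH}}$ is the Gromov--Hausdorff distance between compact metric spaces (half the infimum of distortions of correspondences). The group $C_2$ of order two acts antipodally on each sphere; a map between $C_2$-spaces is odd if it is $C_2$-equivariant. The coindex of a $C_2$-space $X$ is $\mathrm{coind}(X):=\sup\{k\ge0:\text{there is a continuous odd map }\mathbb S^k\to X\}$. $\mathrm{VR}(X;r)$ is the geometric realization of the simplicial complex with vertex set $X$ whose simplices are the nonempty finite subsets of diameter at most $r$; $\mathrm{VR}(\mathbb S^m;r)$ carries the $C_2$-action induced by the antipodal map. For integers $0\le m\le n$, $c_{m,n}:=\inf\{r\ge0:\mathrm{coind}(\mathrm{VR}(\mathbb S^m;r))\ge n\}$. For $\lambda>1$, $\Phi_\chi(\lambda):=\max_{0<x<\pi/2}\left[x-\arcsin\bigl((\sin x)^\lambda\bigr)\right]$. *)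

theory Defs
  imports "HOL-Analysis.Analysis"
begin

section \<open>Gromov--Hausdorff distance\<close>

text \<open>Metric spaces are given by a carrier and a distance function.  All suprema and infima below
  are taken in the reals; they are meaningful for nonempty bounded spaces, in particular for
  nonempty compact ones.\<close>

definition correspondence :: "'a set \<Rightarrow> 'b set \<Rightarrow> ('a \<times> 'b) set \<Rightarrow> bool" where
  "correspondence A B R \<longleftrightarrow> R \<subseteq> A \<times> B \<and> fst ` R = A \<and> snd ` R = B"

definition distortion ::
    "('a \<Rightarrow> 'a \<Rightarrow> real) \<Rightarrow> ('b \<Rightarrow> 'b \<Rightarrow> real) \<Rightarrow> ('a \<times> 'b) set \<Rightarrow> real" where
  "distortion dA dB R = Sup {\<bar>dA a a' - dB b b'\<bar> | a a' b b'. (a, b) \<in> R \<and> (a', b') \<in> R}"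

definition gromov_hausdorff ::
    "'a set \<Rightarrow> ('a \<Rightarrow> 'a \<Rightarrow> real) \<Rightarrow> 'b set \<Rightarrow> ('b \<Rightarrow> 'b \<Rightarrow> real) \<Rightarrow> real" where
  "gromov_hausdorff A dA B dB = Inf {distortion dA dB R | R. correspondence A B R} / 2"

section \<open>Spheres\<close>

text \<open>The underlying set of the \<open>m\<close>-sphere is \<open>topspace (nsphere m)\<close>, whose points are the functions
  \<open>nat \<Rightarrow> real\<close> that vanish above index \<open>m\<close> and have Euclidean norm 1.\<close>

definition sphere_dist :: "nat \<Rightarrow> (nat \<Rightarrow> real) \<Rightarrow> (nat \<Rightarrow> real) \<Rightarrow> real" where
  "sphere_dist m x y = arccos (\<Sum>i\<le>m. x i * y i)"

definition antipode :: "(nat \<Rightarrow> real) \<Rightarrow> (nat \<Rightarrow> real)" where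
  "antipode x = (\<lambda>i. - x i)"

definition GH_sphere :: "nat \<Rightarrow> nat \<Rightarrow> real" where
  "GH_sphere m n =
     gromov_hausdorff (topspace (nsphere m)) (sphere_dist m) (topspace (nsphere n)) (sphere_dist n)"

section \<open>Geometric realization and Vietoris--Rips complexes\<close>

text \<open>A simplicial complex is given by its set \<open>K\<close> of simplices, which are nonempty finite sets
  of vertices.  Points of the realization are written in barycentric coordinates.\<close>

definition closed_simplex :: "'a set \<Rightarrow> ('a \<Rightarrow> real) set" where
  "closed_simplex s = {t. (\<forall>x. 0 \<le> t x) \<and> (\<forall>x. x \<notin> s \<longrightarrow> t x = 0) \<and> (\<Sum>x\<in>s. t x) = 1}"

text \<open>The realization carries the weak topology: a set is open iff its trace on every closed simplex
  is open there.  On a single closed simplex with finite vertex set the product topology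
  is the Euclidean one, since only finitely many coordinates are nonzero.\<close>

definition realization_open :: "'a set set \<Rightarrow> ('a \<Rightarrow> real) set \<Rightarrow> bool" where
  "realization_open K U \<longleftrightarrow>
     U \<subseteq> (\<Union>s\<in>K. closed_simplex s) \<and>
     (\<forall>s\<in>K. openin (subtopology (powertop_real UNIV) (closed_simplex s)) (U \<inter> closed_simplex s))"

definition geometric_realization :: "'a set set \<Rightarrow> ('a \<Rightarrow> real) topology" where
  "geometric_realization K = topology (realization_open K)"

lemma istopology_realization_open: "istopology (realization_open K)"
  unfolding istopology_def
proof (intro conjI allI impI)
  fix S T assume S: "realization_open K S" and T: "realization_open K T"
  have "openin (subtopology (powertop_real UNIV) (closed_simplex s)) (S \<inter> T \<inter> closed_simplex s)"
    if "s \<in> K" for s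
  proof -
    have "S \<inter> T \<inter> closed_simplex s = (S \<inter> closed_simplex s) \<inter> (T \<inter> closed_simplex s)" by blast
    then show ?thesis
      using S T that by (simp add: realization_open_def openin_Int)
  qed
  then show "realization_open K (S \<inter> T)"
    using S unfolding realization_open_def by blast
next
  fix \<K> assume *: "\<forall>U\<in>\<K>. realization_open K U"
  have "openin (subtopology (powertop_real UNIV) (closed_simplex s)) (\<Union>\<K> \<inter> closed_simplex s)"
    if "s \<in> K" for s
  proof -
    have "\<Union>\<K> \<inter> closed_simplex s = (\<Union>U\<in>\<K>. U \<inter> closed_simplex s)" by blast
    moreover have "openin (subtopology (powertop_real UNIV) (closed_simplex s))
                     (\<Union>U\<in>\<K>. U \<inter> closed_simplex s)"
      using * that by (intro openin_Union) (auto simp: realization_open_def)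
    ultimately show ?thesis by simp
  qed
  then show "realization_open K (\<Union>\<K>)"
    using * unfolding realization_open_def by blast
qed

lemma openin_geometric_realization:
  "openin (geometric_realization K) U \<longleftrightarrow> realization_open K U"
  by (simp add: geometric_realization_def istopology_realization_open)

lemma topspace_geometric_realization:
  "topspace (geometric_realization K) = (\<Union>s\<in>K. closed_simplex s)"
proof -
  have "realization_open K (\<Union>s\<in>K. closed_simplex s)"
    unfolding realization_open_def
  proof (intro conjI ballI order_refl)
    fix s assume "s \<in> K"
    then have "(\<Union>s\<in>K. closed_simplex s) \<inter> closed_simplex s = closed_simplex s" by blast
    then show "openin (subtopology (powertop_real UNIV) (closed_simplex s))
                 ((\<Union>s\<in>K. closed_simplex s) \<inter> closed_simplex s)"
      by (simp add: openin_subtopology_refl)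
  qed
  then show ?thesis
    unfolding topspace_def openin_geometric_realization
    by (auto simp: realization_open_def)
qed

definition VR_simplices :: "'a set \<Rightarrow> ('a \<Rightarrow> 'a \<Rightarrow> real) \<Rightarrow> real \<Rightarrow> 'a set set" where
  "VR_simplices X d r =
     {s. finite s \<and> s \<noteq> {} \<and> s \<subseteq> X \<and> (\<forall>x\<in>s. \<forall>y\<in>s. d x y \<le> r)}"

definition VR_sphere :: "nat \<Rightarrow> real \<Rightarrow> ((nat \<Rightarrow> real) \<Rightarrow> real) topology" where
  "VR_sphere m r =
     geometric_realization (VR_simplices (topspace (nsphere m)) (sphere_dist m) r)"

text \<open>The simplicial map induced by the antipodal map pushes barycentric coordinates forward
  along it; as the antipodal map is an involution, this is precomposition.\<close>

definition VR_antipode :: "((nat \<Rightarrow> real) \<Rightarrow> real) \<Rightarrow> ((nat \<Rightarrow> real) \<Rightarrow> real)" where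
  "VR_antipode t = t \<circ> antipode"

section \<open>Coindex\<close>

text \<open>A \<open>C\<^sub>2\<close>-space is a topology \<open>X\<close> together with the involution \<open>\<tau>\<close> by which the
  generator acts.\<close>

definition odd_map :: "nat \<Rightarrow> 'a topology \<Rightarrow> ('a \<Rightarrow> 'a) \<Rightarrow> ((nat \<Rightarrow> real) \<Rightarrow> 'a) \<Rightarrow> bool" where
  "odd_map k X \<tau> f \<longleftrightarrow>
     continuous_map (nsphere k) X f \<and> (\<forall>x\<in>topspace (nsphere k). f (antipode x) = \<tau> (f x))"

text \<open>The coindex may be infinite.  For empty \<open>X\<close> the supremum is 0 by the \<open>enat\<close> convention;
  the Vietoris--Rips complexes with \<open>r \<ge> 0\<close> are never empty.\<close>

definition coind :: "'a topology \<Rightarrow> ('a \<Rightarrow> 'a) \<Rightarrow> enat" where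
  "coind X \<tau> = Sup {enat k | k. \<exists>f. odd_map k X \<tau> f}"

definition c_threshold :: "nat \<Rightarrow> nat \<Rightarrow> real" where
  "c_threshold m n = Inf {r. 0 \<le> r \<and> enat n \<le> coind (VR_sphere m r) VR_antipode}"

section \<open>The function \<open>\<Phi>\<^sub>\<chi>\<close> and the critical ratio\<close>

definition Phi_chi :: "real \<Rightarrow> real" where
  "Phi_chi l = (SUP x\<in>{0<..<pi/2}. x - arcsin (sin x powr l))"

text \<open>For \<open>l > 1\<close> the supremum is a maximum.\<close>

lemma Phi_chi_attained:
  assumes "1 < l"
  shows "\<exists>x\<in>{0<..<pi/2}. Phi_chi l = x - arcsin (sin x powr l) \<and>
           (\<forall>y\<in>{0<..<pi/2}. y - arcsin (sin y powr l) \<le> x - arcsin (sin x powr l))"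
proof -
  define g where "g = (\<lambda>x::real. x - arcsin (sin x powr l))"
  have sin01: "0 \<le> sin x \<and> sin x \<le> 1" if "x \<in> {0..pi/2}" for x :: real
    using that by (auto intro!: sin_ge_zero)
  have pow01: "0 \<le> sin x powr l \<and> sin x powr l \<le> 1" if "x \<in> {0..pi/2}" for x :: real
    using sin01[OF that] assms by (auto intro!: powr_le1)
  have "continuous_on {0..pi/2} g"
    unfolding g_def
    using sin01 pow01 assms
    by (intro continuous_on_diff continuous_on_id continuous_on_arcsin continuous_on_powr'
        continuous_on_sin continuous_on_const ballI conjI) (force intro: order_trans[of _ 0])+
  then obtain x where x: "x \<in> {0..pi/2}" and max: "\<And>y. y \<in> {0..pi/2} \<Longrightarrow> g y \<le> g x"
    using continuous_attains_sup[of "{0..pi/2}" g] by auto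
  have p: "pi/4 \<in> {0..pi/2}" using pi_gt_zero by simp
  have s: "0 < sin (pi/4::real)" "sin (pi/4::real) < 1"
    using sin_gt_zero[of "pi/4"] sin_monotone_2pi[of "pi/4" "pi/2"] pi_gt_zero by auto
  have "sin (pi/4::real) powr l < sin (pi/4) powr 1"
    using s assms by (intro powr_less_mono') auto
  also have "\<dots> = sin (pi/4)" using s(1) by (intro powr_one) linarith
  finally have "arcsin (sin (pi/4) powr l) < arcsin (sin (pi/4))"
    using s pow01[OF p] by (intro arcsin_less_arcsin) linarith+
  also have "\<dots> = pi/4" using pi_gt_zero by (intro arcsin_sin) auto
  finally have "0 < g x" using max[OF p] by (simp add: g_def)
  moreover have "g 0 = 0" "g (pi/2) = 0" using assms by (auto simp: g_def)
  ultimately have "x \<noteq> 0" "x \<noteq> pi/2" by (metis less_irrefl)+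
  with x have xin: "x \<in> {0<..<pi/2}" by auto
  have "Phi_chi l = g x"
    unfolding Phi_chi_def g_def[symmetric]
    using xin max by (intro cSup_eq_maximum) (auto simp: g_def)
  then show ?thesis using xin max by (auto simp: g_def)
qed

definition ratio_star :: "real \<Rightarrow> real" where
  "ratio_star x = ln (sin (x - pi/4)) / ln (sin x)"

definition lambda_star :: real where
  "lambda_star = (INF x\<in>{pi/4<..<pi/2}. ratio_star x)"

end

theory Submission
  imports Defs
begin

text \<open>
  The theorem combines two independent asymptotic estimates, for \<open>n / m \<rightarrow> l\<close> and \<open>m \<rightarrow> \<infinity>\<close>.

  The threshold is at most \<open>\<pi>/2 + o(1)\<close>.  Suppose that \<open>n + 1\<close> unit vectors in \<open>\<real>\<^sup>m\<^sup>+\<^sup>1\<close> have pairwise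
  inner products of absolute value at most \<open>c\<close>.  Together with their antipodes they are the vertices
  of a cross-polytope whose boundary, an \<open>n\<close>-sphere, maps oddly to the Vietoris--Rips complex
  at scale \<open>arccos (- c)\<close>: a simplex never contains an antipodal pair
  (\<open>c_threshold_le_of_almost_orthogonal\<close>).  Incidence vectors of lines in a grid give as many such vectors
  as any fixed multiple of the dimension, with \<open>c\<close> as small as desired (\<open>almost_orthogonal_lines\<close>).

  The Gromov--Hausdorff distance is asymptotically at least \<open>x - arcsin ((sin x)\<^sup>l)\<close>, for every \<open>x < \<pi>/2\<close>
  with \<open>sin x \<ge> 1/2\<close>.  Take a correspondence of distortion below \<open>2 \<eta>\<close> and put \<open>\<rho> = x - \<eta>\<close>.  The points of
  the \<open>n\<close>-sphere that correspond to a cap of radius \<open>\<rho>\<close> in the \<open>m\<close>-sphere form a set of angular diameter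
  below \<open>2 x\<close>, and an isodiametric inequality bounds its share of the \<open>n\<close>-sphere by \<open>(sin x)\<^sup>n\<^sup>+\<^sup>1\<close>.  On
  average over the centre of the cap, this share is the share of the cap itself in the \<open>m\<close>-sphere,
  which is \<open>(sin \<rho>)\<^sup>m\<close> up to subexponential factors (\<open>cap_volume_bound_of_correspondence\<close>,
  \<open>cone_volume_lower_bound\<close>).  Hence \<open>sin \<rho> \<le> (sin x)\<^sup>l\<close> in the limit, which bounds \<open>\<eta>\<close> from below.

  So the gap is asymptotically at least \<open>x - arcsin ((sin x)\<^sup>l) - \<pi>/4\<close> (\<open>liminf_gap_ge\<close>).  Taking logarithms,
  this is positive for some \<open>x\<close> exactly if \<open>l\<close> exceeds the minimum of \<open>ratio_star\<close>.  For \<open>l \<ge> 9\<close> the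
  choice \<open>x = 3 \<pi> / 10\<close> is explicit, because \<open>sin x\<close> is then half the golden ratio.

  Shares of spheres are measured by the cones that sets of directions span in the open unit ball, so
  that only Lebesgue measure is needed.  Since the dimension is a term and has to vary
  along a sequence, \<open>\<real>\<^sup>I\<close> is the product measure space over a finite index set \<open>I\<close>.
\<close>

section \<open>The Prekopa--Leindler inequality\<close>

lemma emeasure_lborel_halved:
  fixes X :: "real set"
  assumes [measurable]: "X \<in> sets borel"
  shows "2 * emeasure lborel {z. 2 * z - t \<in> X} = emeasure lborel X"
proof -
  have "emeasure lborel X = (\<integral>\<^sup>+x. indicator X x \<partial>lborel)" by simp
  also have "\<dots> = 2 * (\<integral>\<^sup>+z. indicator X (- t + 2 * z) \<partial>lborel)"
    by (subst nn_integral_real_affine[where c = 2 and t = "-t"]) auto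
  also have "(\<integral>\<^sup>+z. indicator X (- t + 2 * z) \<partial>lborel)
      = (\<integral>\<^sup>+z. indicator {z. 2 * z - t \<in> X} z \<partial>lborel)"
    by (intro nn_integral_cong) (auto simp: indicator_def)
  also have "\<dots> = emeasure lborel {z. 2 * z - t \<in> X}"
    by (intro nn_integral_indicator) measurable
  finally show ?thesis by simp
qed

text \<open>Stands in for the maximum in the one-dimensional Brunn--Minkowski inequality, so that the sets
  there need not be compact.\<close>

lemma almost_maximal_element:
  fixes X :: "real set"
  assumes [measurable]: "X \<in> sets borel" and X: "X \<noteq> {}" "emeasure lborel X < \<infinity>" and e: "0 < e"
  shows "\<exists>a\<in>X. emeasure lborel (X \<inter> {a<..}) \<le> ennreal e"
proof (cases "bdd_above X")
  case True
  obtain a where a: "a \<in> X" "Sup X - e < a" using less_cSupE[of "Sup X - e" X] X e by auto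
  have "X \<inter> {a<..} \<subseteq> {a..Sup X}" using cSup_upper[OF _ True] by auto
  then have "emeasure lborel (X \<inter> {a<..}) \<le> emeasure lborel {a..Sup X}" by (intro emeasure_mono) auto
  also have "\<dots> \<le> ennreal e" using a cSup_upper[OF a(1) True] by (simp add: ennreal_leI)
  finally show ?thesis using a by blast
next
  case False
  have "(\<lambda>k. emeasure lborel (X \<inter> {real k<..})) \<longlonglongrightarrow> emeasure lborel (\<Inter>k. X \<inter> {real k<..})"
  proof (rule Lim_emeasure_decseq)
    show "emeasure lborel (X \<inter> {real i<..}) \<noteq> \<infinity>" for i
      using X emeasure_mono[of "X \<inter> {real i<..}" X lborel] by (auto simp: top_unique)
  qed (auto simp: decseq_def)
  moreover have "(\<Inter>k. X \<inter> {real k<..}) = {}"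
  proof -
    have "\<exists>k. \<not> real k < y" for y :: real using reals_Archimedean2[of y] by (meson less_asym)
    then show ?thesis by auto
  qed
  ultimately have "(\<lambda>k. emeasure lborel (X \<inter> {real k<..})) \<longlonglongrightarrow> 0" by simp
  from order_tendstoD(2)[OF this, of "ennreal e"] e
  obtain k where k: "emeasure lborel (X \<inter> {real k<..}) < ennreal e"
    by (auto simp: eventually_sequentially)
  obtain a where a: "a \<in> X" "real k < a" using False by (meson bdd_above.I not_le)
  have "emeasure lborel (X \<inter> {a<..}) \<le> emeasure lborel (X \<inter> {real k<..})"
    using a by (intro emeasure_mono) auto
  with k a show ?thesis by (meson less_imp_le order_trans)
qed

text \<open>The translates of \<open>A\<close> by a minimal element of \<open>B\<close> and of \<open>B\<close> by a maximal element of \<open>A\<close> overlap in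
  one point only, and both lie in \<open>A + B\<close>.\<close>

lemma brunn_minkowski_real:
  fixes A B C :: "real set"
  assumes [measurable]: "A \<in> sets borel" "B \<in> sets borel" "C \<in> sets borel"
    and ne: "A \<noteq> {}" "B \<noteq> {}"
    and mid: "\<And>a b. a \<in> A \<Longrightarrow> b \<in> B \<Longrightarrow> (a + b) / 2 \<in> C"
  shows "emeasure lborel A + emeasure lborel B \<le> 2 * emeasure lborel C"
proof (cases "emeasure lborel A < \<infinity> \<and> emeasure lborel B < \<infinity>")
  case False
  obtain a b where ab: "a \<in> A" "b \<in> B" using ne by auto
  have "{z. 2 * z - b \<in> A} \<subseteq> C" "{z. 2 * z - a \<in> B} \<subseteq> C"
    using mid[OF _ ab(2), of "2 * z - b" for z] mid[OF ab(1), of "2 * z - a" for z] by auto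
  then have "emeasure lborel A \<le> 2 * emeasure lborel C" "emeasure lborel B \<le> 2 * emeasure lborel C"
    unfolding emeasure_lborel_halved[of A b, symmetric, OF assms(1)]
              emeasure_lborel_halved[of B a, symmetric, OF assms(2)]
    by (auto intro!: mult_left_mono emeasure_mono)
  with False show ?thesis by (auto simp: not_less top_unique)
next
  case True
  show ?thesis
  proof (rule ennreal_le_epsilon)
    fix e :: real assume e: "0 < e"
    obtain a where a: "a \<in> A" "emeasure lborel (A \<inter> {a<..}) \<le> ennreal (e/2)"
      using almost_maximal_element[of A "e/2"] ne True e by auto
    define B' where "B' = uminus -` B"
    have [measurable]: "B' \<in> sets borel" unfolding B'_def
      by (auto intro!: measurable_sets_borel[of _ borel])
    have refl: "emeasure lborel (uminus -` X) = emeasure lborel X" if "X \<in> sets borel" for X :: "real set"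
      using emeasure_distr[of uminus lborel borel X] that by (simp add: lborel_distr_uminus)
    have B'_ne: "B' \<noteq> {}" using ne(2) by (auto simp: B'_def) (metis minus_minus vimageI2 empty_iff)
    obtain b' where b': "b' \<in> B'" "emeasure lborel (B' \<inter> {b'<..}) \<le> ennreal (e/2)"
      using almost_maximal_element[of B' "e/2"] True e refl[of B] B'_ne
      by (auto simp flip: B'_def)
    define b where "b = - b'"
    have "uminus -` (B \<inter> {..<b}) = B' \<inter> {b'<..}" by (auto simp: B'_def b_def)
    then have b: "b \<in> B" "emeasure lborel (B \<inter> {..<b}) \<le> ennreal (e/2)"
      using b' refl[of "B \<inter> {..<b}"] by (auto simp: B'_def b_def)
    (* Midpoints of b with the part of A below a lie left of (a + b)/2; those of a with the part of B
       from b on do not. *)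
    let ?P = "{z. 2 * z - b \<in> A \<inter> {..<a}}" and ?Q = "{z. 2 * z - a \<in> B \<inter> {b..}}"
    have "emeasure lborel ?P + emeasure lborel ?Q = emeasure lborel (?P \<union> ?Q)"
      by (intro plus_emeasure) (measurable, auto)
    also have "\<dots> \<le> emeasure lborel C"
    proof (intro emeasure_mono subsetI)
      fix z assume "z \<in> ?P \<union> ?Q"
      then show "z \<in> C"
        using mid[OF _ b(1), of "2 * z - b"] mid[OF a(1), of "2 * z - a"] by auto
    qed auto
    finally have "2 * emeasure lborel ?P + 2 * emeasure lborel ?Q \<le> 2 * emeasure lborel C"
      unfolding distrib_left[symmetric] by (rule mult_left_mono) simp
    then have PQ: "emeasure lborel (A \<inter> {..<a}) + emeasure lborel (B \<inter> {b..}) \<le> 2 * emeasure lborel C"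
      using emeasure_lborel_halved[of "A \<inter> {..<a}" b] emeasure_lborel_halved[of "B \<inter> {b..}" a] by simp
    have "emeasure lborel A \<le> emeasure lborel (A \<inter> {..<a} \<union> {a} \<union> A \<inter> {a<..})"
      by (intro emeasure_mono) auto
    also have "\<dots> \<le> emeasure lborel (A \<inter> {..<a}) + emeasure lborel {a} + emeasure lborel (A \<inter> {a<..})"
      by (intro order_trans[OF emeasure_subadditive] add_mono) auto
    finally have A: "emeasure lborel A \<le> emeasure lborel (A \<inter> {..<a}) + ennreal (e/2)"
      using a(2) by (auto elim: order_trans intro: add_left_mono)
    have "emeasure lborel B \<le> emeasure lborel (B \<inter> {b..} \<union> B \<inter> {..<b})"
      by (intro emeasure_mono) auto
    also have "\<dots> \<le> emeasure lborel (B \<inter> {b..}) + emeasure lborel (B \<inter> {..<b})"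
      by (intro emeasure_subadditive) auto
    finally have B: "emeasure lborel B \<le> emeasure lborel (B \<inter> {b..}) + ennreal (e/2)"
      using b(2) by (auto elim: order_trans intro: add_left_mono)
    have "emeasure lborel A + emeasure lborel B \<le>
       (emeasure lborel (A \<inter> {..<a}) + emeasure lborel (B \<inter> {b..})) + (ennreal (e/2) + ennreal (e/2))"
      using add_mono[OF A B] by (simp add: ac_simps)
    also have "\<dots> \<le> 2 * emeasure lborel C + ennreal e"
      using PQ e by (intro add_mono) (auto simp flip: ennreal_plus)
    finally show "emeasure lborel A + emeasure lborel B \<le> 2 * emeasure lborel C + ennreal e" .
  qed
qed

lemma measurable_superlevel_volume:
  fixes f :: "real \<Rightarrow> ennreal"
  assumes [measurable]: "f \<in> borel_measurable borel"
  shows "(\<lambda>t. emeasure lborel {x. ennreal (a * t) < f x}) \<in> borel_measurable borel"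
proof -
  have "(\<lambda>t. \<integral>\<^sup>+x. (if ennreal (a * t) < f x then 1 else 0) \<partial>lborel) \<in> borel_measurable borel"
    by measurable
  also have "(\<lambda>t. \<integral>\<^sup>+x. (if ennreal (a * t) < f x then 1 else 0) \<partial>lborel)
      = (\<lambda>t. \<integral>\<^sup>+x. indicator {x. ennreal (a * t) < f x} x \<partial>lborel)"
    by (intro ext nn_integral_cong) (auto simp: indicator_def)
  also have "\<dots> = (\<lambda>t. emeasure lborel {x. ennreal (a * t) < f x})"
    by (intro ext nn_integral_indicator) auto
  finally show ?thesis .
qed

text \<open>The layer-cake formula for the truncation of \<open>f\<close> at height \<open>a\<close>, with heights rescaled to the
  unit interval so that the layers of functions with different bounds can be compared.\<close>

lemma nn_integral_min_layers:
  fixes f :: "real \<Rightarrow> ennreal"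
  assumes [measurable]: "f \<in> borel_measurable borel" and a: "0 < a" 
  shows "(\<integral>\<^sup>+x. min (ennreal a) (f x) \<partial>lborel)
    = ennreal a * (\<integral>\<^sup>+t\<in>{0<..<1}. emeasure lborel {x. ennreal (a * t) < f x} \<partial>lborel)"
proof -
  have layer: "min (ennreal a) u = (\<integral>\<^sup>+t. ennreal a * (indicator {0<..<1} t * indicator {t. ennreal (a * t) < u} t) \<partial>lborel)"
    for u :: ennreal
  proof -
    have "(\<integral>\<^sup>+t. ennreal a * (indicator {0<..<1} t * indicator {t. ennreal (a * t) < u} t) \<partial>lborel)
      = ennreal a * (\<integral>\<^sup>+t. indicator {t. 0 < t \<and> t < 1 \<and> ennreal (a * t) < u} t \<partial>lborel)"
      by (subst nn_integral_cmult[symmetric]) (auto intro!: nn_integral_cong simp: indicator_def)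
    also have "(\<integral>\<^sup>+t. indicator {t. 0 < t \<and> t < 1 \<and> ennreal (a * t) < u} t \<partial>lborel) = emeasure lborel {t. 0 < t \<and> t < 1 \<and> ennreal (a * t) < u}"
      by (intro nn_integral_indicator) auto
    also have "ennreal a * \<dots> = min (ennreal a) u"
    proof (cases u)
      case top
      have "{t::real. 0 < t \<and> t < 1} = {0<..<1}" by auto
      then show ?thesis using top by simp
    next
      case (real r)
      have "{t. 0 < t \<and> t < 1 \<and> ennreal (a * t) < u} = {0<..<min 1 (r / a)}"
        using a real by (auto simp: ennreal_less_iff field_simps)
      moreover have "a * min 1 (r / a) = min a r" using a by (auto simp: min_def field_simps)
      ultimately show ?thesis using a real
        by (simp flip: ennreal_mult add: min_def ennreal_le_iff)
    qed
    finally show ?thesis by simp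
  qed
  have "(\<integral>\<^sup>+x. min (ennreal a) (f x) \<partial>lborel)
     = (\<integral>\<^sup>+x. (\<integral>\<^sup>+t. ennreal a * (indicator {0<..<1} t * indicator {t. ennreal (a * t) < f x} t) \<partial>lborel) \<partial>lborel)"
    by (intro nn_integral_cong layer)
  also have "\<dots> = (\<integral>\<^sup>+x. (\<integral>\<^sup>+t. ennreal a * (indicator {0<..<1} t * (if ennreal (a * t) < f x then 1 else 0)) \<partial>lborel) \<partial>lborel)"
    by (intro nn_integral_cong) (auto simp: indicator_def)
  also have "\<dots> = (\<integral>\<^sup>+t. (\<integral>\<^sup>+x. ennreal a * (indicator {0<..<1} t * (if ennreal (a * t) < f x then 1 else 0)) \<partial>lborel) \<partial>lborel)"
    by (rule lborel_pair.Fubini') measurable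
  also have "\<dots> = (\<integral>\<^sup>+t. ennreal a * (emeasure lborel {x. ennreal (a * t) < f x} * indicator {0<..<1} t) \<partial>lborel)"
  proof (intro nn_integral_cong)
    fix t :: real
    have "(\<integral>\<^sup>+x. ennreal a * (indicator {0<..<1} t * (if ennreal (a * t) < f x then 1 else 0)) \<partial>lborel)
       = (\<integral>\<^sup>+x. ennreal a * indicator {0<..<1} t * indicator {x. ennreal (a * t) < f x} x \<partial>lborel)"
      by (intro nn_integral_cong) (auto simp: indicator_def)
    also have "\<dots> = ennreal a * indicator {0<..<1} t * emeasure lborel {x. ennreal (a * t) < f x}"
      by (intro nn_integral_cmult_indicator) auto
    finally show "(\<integral>\<^sup>+x. ennreal a * (indicator {0<..<1} t * (if ennreal (a * t) < f x then 1 else 0)) \<partial>lborel) = ennreal a * (emeasure lborel {x. ennreal (a * t) < f x} * indicator {0<..<1} t)" by (simp add: ac_simps)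
  qed
  also have "\<dots> = ennreal a * (\<integral>\<^sup>+t\<in>{0<..<1}. emeasure lborel {x. ennreal (a * t) < f x} \<partial>lborel)"
    using measurable_superlevel_volume[of f a] by (intro nn_integral_cmult) measurable
  finally show ?thesis .
qed

lemma ennreal_mult_le_square:
  fixes P Q S :: ennreal
  assumes "P + Q \<le> 2 * S"
  shows "P * Q \<le> S\<^sup>2"
proof (cases "S = top")
  case True
  then show ?thesis by (simp add: power2_eq_square)
next
  case False
  then have "2 * S < top" by (simp add: ennreal_mult_less_top less_top)
  then have "P < top" "Q < top" using assms by (auto simp: ennreal_add_less_top dest: le_less_trans)
  with False obtain p q s where
    *: "P = ennreal p" "Q = ennreal q" "S = ennreal s" "0 \<le> p" "0 \<le> q" "0 \<le> s"
    by (metis ennreal_cases less_irrefl)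
  then have "p + q \<le> 2 * s" using assms
    by (simp flip: ennreal_plus ennreal_numeral ennreal_mult)
  then have "(p + q)\<^sup>2 \<le> (2 * s)\<^sup>2" using * by (intro power_mono) auto
  moreover have "0 \<le> (p - q)\<^sup>2" by simp
  ultimately have "p * q \<le> s\<^sup>2" by (simp add: power2_eq_square algebra_simps)
  then show ?thesis using * by (simp add: power2_eq_square ennreal_leI flip: ennreal_mult)
qed

lemma ennreal_mult_less_mult:
  fixes p q :: ennreal
  assumes "ennreal u < p" "ennreal v < q" "0 \<le> u" "0 \<le> v"
  shows "ennreal u * ennreal v < p * q"
proof -
  have "p \<noteq> 0" "q \<noteq> 0" using assms by auto
  moreover have "u * v < r * t" if "p = ennreal r" "q = ennreal t" "0 \<le> r" "0 \<le> t" for r t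
    using that assms by (intro mult_strict_mono') (auto simp: ennreal_less_iff)
  ultimately show ?thesis using assms
    by (cases p; cases q) (auto simp: ennreal_mult_top ennreal_top_mult ennreal_less_iff simp flip: ennreal_mult)
qed

text \<open>The superlevel sets of \<open>f\<close>, \<open>g\<close>, \<open>h\<close> at heights \<open>a t\<close>, \<open>b t\<close>, \<open>c t\<close> with \<open>c\<^sup>2 = a b\<close> satisfy the hypothesis of
  the Brunn--Minkowski inequality.  The bounds on \<open>a\<close> and \<open>b\<close> make the first two of them nonempty for \<open>t < 1\<close>.
  Integrating over \<open>t\<close> gives an arithmetic mean, which dominates the geometric one.\<close>

lemma prekopa_leindler_truncated:
  fixes f g h :: "real \<Rightarrow> ennreal"
  assumes [measurable]: "f \<in> borel_measurable borel" "g \<in> borel_measurable borel" "h \<in> borel_measurable borel"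
    and mid: "\<And>x y. f x * g y \<le> (h ((x + y) / 2))\<^sup>2"
    and a: "0 < a" "ennreal a \<le> (SUP x. f x)" and b: "0 < b" "ennreal b \<le> (SUP x. g x)"
  shows "(\<integral>\<^sup>+x. min (ennreal a) (f x) \<partial>lborel) * (\<integral>\<^sup>+x. min (ennreal b) (g x) \<partial>lborel)
    \<le> (\<integral>\<^sup>+x. h x \<partial>lborel)\<^sup>2"
proof -
  define c where "c = sqrt (a * b)"
  have c: "0 < c" "c * c = a * b" using a b by (auto simp: c_def)
  define P Q S where
    "P = (\<integral>\<^sup>+t\<in>{0<..<1}. emeasure lborel {x. ennreal (a * t) < f x} \<partial>lborel)" and
    "Q = (\<integral>\<^sup>+t\<in>{0<..<1}. emeasure lborel {x. ennreal (b * t) < g x} \<partial>lborel)" and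
    "S = (\<integral>\<^sup>+t\<in>{0<..<1}. emeasure lborel {x. ennreal (c * t) < h x} \<partial>lborel)"
  note [measurable] = measurable_superlevel_volume[of f a] measurable_superlevel_volume[of g b]
    measurable_superlevel_volume[of h c]
  have levels: "emeasure lborel {x. ennreal (a * t) < f x} + emeasure lborel {x. ennreal (b * t) < g x}
      \<le> 2 * emeasure lborel {x. ennreal (c * t) < h x}" if t: "0 < t" "t < 1" for t
  proof (rule brunn_minkowski_real)
    have "ennreal (a * t) < ennreal a" using a t by (intro ennreal_lessI) auto
    then show "{x. ennreal (a * t) < f x} \<noteq> {}"
      using less_le_trans[OF _ a(2)] by (auto simp: less_SUP_iff)
    have "ennreal (b * t) < ennreal b" using b t by (intro ennreal_lessI) auto
    then show "{x. ennreal (b * t) < g x} \<noteq> {}"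
      using less_le_trans[OF _ b(2)] by (auto simp: less_SUP_iff)
    fix x y assume x: "x \<in> {x. ennreal (a * t) < f x}" and y: "y \<in> {x. ennreal (b * t) < g x}"
    show "(x + y) / 2 \<in> {x. ennreal (c * t) < h x}"
    proof (rule ccontr)
      assume "(x + y) / 2 \<notin> {x. ennreal (c * t) < h x}"
      then have "h ((x + y) / 2) \<le> ennreal (c * t)" by (simp add: not_less)
      then have "(h ((x + y) / 2))\<^sup>2 \<le> (ennreal (c * t))\<^sup>2" by (intro power_mono) auto
      also have "\<dots> = ennreal ((c * c) * (t * t))"
        using c(1) t by (simp add: power2_eq_square mult_ac flip: ennreal_mult)
      also have "\<dots> = ennreal (a * t) * ennreal (b * t)"
        unfolding c(2) using a b t by (simp add: mult_ac flip: ennreal_mult)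
      also have "\<dots> < f x * g y" using x y using a b t by (intro ennreal_mult_less_mult) auto
      also have "\<dots> \<le> (h ((x + y) / 2))\<^sup>2" by (rule mid)
      finally show False by simp
    qed
  qed measurable
  have "P + Q = (\<integral>\<^sup>+t\<in>{0<..<1}. (emeasure lborel {x. ennreal (a * t) < f x} + emeasure lborel {x. ennreal (b * t) < g x}) \<partial>lborel)"
    unfolding P_def Q_def by (subst nn_integral_add[symmetric]) (auto intro!: nn_integral_cong simp: algebra_simps)
  also have "\<dots> \<le> (\<integral>\<^sup>+t. 2 * (emeasure lborel {x. ennreal (c * t) < h x} * indicator {0<..<1} t) \<partial>lborel)"
    using levels by (intro nn_integral_mono) (auto simp: indicator_def)
  also have "\<dots> = 2 * S" unfolding S_def by (intro nn_integral_cmult) measurable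
  finally have PQ: "P * Q \<le> S\<^sup>2" by (rule ennreal_mult_le_square)
  have "(\<integral>\<^sup>+x. min (ennreal a) (f x) \<partial>lborel) * (\<integral>\<^sup>+x. min (ennreal b) (g x) \<partial>lborel)
     = ennreal (a * b) * (P * Q)"
    using a b by (simp add: nn_integral_min_layers P_def Q_def ennreal_mult ac_simps)
  also have "\<dots> \<le> ennreal (a * b) * S\<^sup>2" using PQ by (rule mult_left_mono) simp
  also have "\<dots> = (\<integral>\<^sup>+x. min (ennreal c) (h x) \<partial>lborel)\<^sup>2"
    using c(1) by (simp add: nn_integral_min_layers S_def power2_eq_square ac_simps ennreal_mult flip: c(2))
  also have "\<dots> \<le> (\<integral>\<^sup>+x. h x \<partial>lborel)\<^sup>2" by (intro power_mono nn_integral_mono) auto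
  finally show ?thesis .
qed

text \<open>The inequality is stated for squares, which avoids roots in the extended nonnegative reals.\<close>

lemma prekopa_leindler_real:
  fixes f g h :: "real \<Rightarrow> ennreal"
  assumes [measurable]: "f \<in> borel_measurable borel" "g \<in> borel_measurable borel" "h \<in> borel_measurable borel"
    and mid: "\<And>x y. f x * g y \<le> (h ((x + y) / 2))\<^sup>2"
  shows "(\<integral>\<^sup>+x. f x \<partial>lborel) * (\<integral>\<^sup>+x. g x \<partial>lborel) \<le> (\<integral>\<^sup>+x. h x \<partial>lborel)\<^sup>2"
proof -
  have trunc: "(\<integral>\<^sup>+x. min (of_nat k) (f x) \<partial>lborel) * (\<integral>\<^sup>+x. min (of_nat k) (g x) \<partial>lborel)
      \<le> (\<integral>\<^sup>+x. h x \<partial>lborel)\<^sup>2" for k :: nat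
  proof (cases "k = 0 \<or> (SUP x. f x) = 0 \<or> (SUP x. g x) = 0")
    case True
    moreover have null: "u = (\<lambda>_. 0)" if "(SUP x. u x) = 0" for u :: "real \<Rightarrow> ennreal"
    proof
      show "u x = 0" for x using SUP_upper[of x UNIV u] that by simp
    qed
    ultimately consider "k = 0" | "f = (\<lambda>_. 0)" | "g = (\<lambda>_. 0)" by (auto dest: null)
    then show ?thesis by cases simp_all
  next
    case False
    have cut: "\<exists>a>0. ennreal a \<le> (SUP x. u x) \<and> (\<forall>x. min (of_nat k) (u x) = min (ennreal a) (u x))"
      if u: "(SUP x. u x) \<noteq> 0" for u :: "real \<Rightarrow> ennreal"
    proof -
      define U where "U = (SUP x. u x)"
      have U: "U \<noteq> 0" "u x \<le> U" for x using u by (auto simp: U_def intro: SUP_upper)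
      have "min (of_nat k) U \<le> of_nat k" by simp
      then have "min (of_nat k) U < top" using of_nat_less_top by (rule le_less_trans)
      then obtain a where a: "min (of_nat k) U = ennreal a" "0 \<le> a"
        by (cases "min (of_nat k) U") auto
      have "min (of_nat k) U \<noteq> 0" using U(1) False by (simp add: min_def)
      then have "0 < a" using a by (cases "a = 0") auto
      moreover have "min (of_nat k) (u x) = min (ennreal a) (u x)" for x
        unfolding a(1)[symmetric] min.assoc using U(2)[of x] by (simp add: min_absorb2)
      moreover have "ennreal a \<le> U" unfolding a(1)[symmetric] by (rule min.cobounded2)
      ultimately show ?thesis unfolding U_def by blast
    qed
    obtain a b where "0 < a" "ennreal a \<le> (SUP x. f x)" "\<forall>x. min (of_nat k) (f x) = min (ennreal a) (f x)"
       "0 < b" "ennreal b \<le> (SUP x. g x)" "\<forall>x. min (of_nat k) (g x) = min (ennreal b) (g x)"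
      using cut[of f] cut[of g] False by blast
    then show ?thesis using prekopa_leindler_truncated[of f g h a b] mid by simp
  qed
  have lim: "(\<integral>\<^sup>+x. u x \<partial>lborel) = (SUP k. \<integral>\<^sup>+x. min (of_nat k) (u x) \<partial>lborel)"
    and inc: "incseq (\<lambda>k. \<integral>\<^sup>+x. min (of_nat k) (u x) \<partial>lborel)"
    if [measurable]: "u \<in> borel_measurable borel" for u :: "real \<Rightarrow> ennreal"
  proof -
    have mono: "min (of_nat k) v \<le> min (of_nat l) v" if "k \<le> l" for k l :: nat and v :: ennreal
      using that by (intro min.mono of_nat_mono order_refl)
    have "(SUP k. min (of_nat k) v) = v" for v :: ennreal
    proof -
      have "(SUP k. min v (of_nat k)) = min v (SUP k. of_nat k)"
        by (simp add: inf_SUP flip: inf_min)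
      then show ?thesis by (simp add: min.commute ennreal_SUP_of_nat_eq_top)
    qed
    moreover have "incseq (\<lambda>k x. min (of_nat k) (u x))"
      unfolding incseq_def le_fun_def by (blast intro: mono)
    ultimately show "(\<integral>\<^sup>+x. u x \<partial>lborel) = (SUP k. \<integral>\<^sup>+x. min (of_nat k) (u x) \<partial>lborel)"
      by (subst nn_integral_monotone_convergence_SUP[symmetric]) auto
    show "incseq (\<lambda>k. \<integral>\<^sup>+x. min (of_nat k) (u x) \<partial>lborel)"
      unfolding incseq_def by (blast intro: nn_integral_mono mono)
  qed
  show ?thesis
    unfolding lim[of f, OF assms(1)] lim[of g, OF assms(2)] SUP_mult_right_ennreal SUP_mult_left_ennreal
  proof (intro SUP_least)
    fix k l :: nat
    have "(\<integral>\<^sup>+x. min (of_nat k) (f x) \<partial>lborel) * (\<integral>\<^sup>+x. min (of_nat l) (g x) \<partial>lborel)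
      \<le> (\<integral>\<^sup>+x. min (of_nat (max k l)) (f x) \<partial>lborel) * (\<integral>\<^sup>+x. min (of_nat (max k l)) (g x) \<partial>lborel)"
      by (intro mult_mono incseqD[OF inc]) auto
    then show "(\<integral>\<^sup>+x. min (of_nat k) (f x) \<partial>lborel) * (\<integral>\<^sup>+x. min (of_nat l) (g x) \<partial>lborel)
      \<le> (\<integral>\<^sup>+x. h x \<partial>lborel)\<^sup>2" using trunc by (rule order_trans)
  qed
qed

abbreviation lebesgue_on_coords :: "'i set \<Rightarrow> ('i \<Rightarrow> real) measure" where
  "lebesgue_on_coords I \<equiv> PiM I (\<lambda>_. lborel)"

interpretation lborel_product: product_sigma_finite "\<lambda>_. lborel :: real measure"
  by standard

lemma nn_integral_coords_insert:
  fixes f :: "('i \<Rightarrow> real) \<Rightarrow> ennreal"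
  assumes "finite I" "i \<notin> I" and [measurable]: "f \<in> borel_measurable (lebesgue_on_coords (insert i I))"
  shows "(\<lambda>s. \<integral>\<^sup>+x. f (x(i := s)) \<partial>lebesgue_on_coords I) \<in> borel_measurable borel"
    and "\<And>s. (\<lambda>x. f (x(i := s))) \<in> borel_measurable (lebesgue_on_coords I)"
    and "(\<integral>\<^sup>+x. f x \<partial>lebesgue_on_coords (insert i I))
        = (\<integral>\<^sup>+s. (\<integral>\<^sup>+x. f (x(i := s)) \<partial>lebesgue_on_coords I) \<partial>lborel)"
proof -
  interpret finite_product_sigma_finite "\<lambda>_. lborel :: real measure" I by standard fact
  show "(\<lambda>s. \<integral>\<^sup>+x. f (x(i := s)) \<partial>lebesgue_on_coords I) \<in> borel_measurable borel"
    by measurable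
  show "\<And>s. (\<lambda>x. f (x(i := s))) \<in> borel_measurable (lebesgue_on_coords I)"
    by measurable
  show "(\<integral>\<^sup>+x. f x \<partial>lebesgue_on_coords (insert i I))
        = (\<integral>\<^sup>+s. (\<integral>\<^sup>+x. f (x(i := s)) \<partial>lebesgue_on_coords I) \<partial>lborel)"
    by (rule lborel_product.product_nn_integral_insert_rev) fact+
qed

text \<open>Integrating out all coordinates but one preserves the hypothesis, by the induction hypothesis
  applied to slices.  This tensorisation is why the functional form is used rather than
  the inequality for sets.\<close>

lemma prekopa_leindler:
  fixes f g h :: "('i \<Rightarrow> real) \<Rightarrow> ennreal"
  assumes "finite I"
    and "f \<in> borel_measurable (lebesgue_on_coords I)" "g \<in> borel_measurable (lebesgue_on_coords I)"
      "h \<in> borel_measurable (lebesgue_on_coords I)"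
    and "\<And>x y. x \<in> space (lebesgue_on_coords I) \<Longrightarrow> y \<in> space (lebesgue_on_coords I) \<Longrightarrow>
           f x * g y \<le> (h (\<lambda>i\<in>I. (x i + y i) / 2))\<^sup>2"
  shows "(\<integral>\<^sup>+x. f x \<partial>lebesgue_on_coords I) * (\<integral>\<^sup>+x. g x \<partial>lebesgue_on_coords I)
    \<le> (\<integral>\<^sup>+x. h x \<partial>lebesgue_on_coords I)\<^sup>2"
  using assms
proof (induction I arbitrary: f g h)
  case empty
  then show ?case
    using empty(4)[of "\<lambda>_. undefined" "\<lambda>_. undefined"]
    by (simp add: PiM_empty nn_integral_count_space_finite)
next
  case (insert i I)
  note slices = nn_integral_coords_insert[OF insert.hyps]
  have mid: "(\<integral>\<^sup>+x. f (x(i := s)) \<partial>lebesgue_on_coords I) * (\<integral>\<^sup>+x. g (x(i := t)) \<partial>lebesgue_on_coords I)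
     \<le> (\<integral>\<^sup>+x. h (x(i := (s + t) / 2)) \<partial>lebesgue_on_coords I)\<^sup>2" for s t
  proof (rule insert.IH)
    fix x y assume xy: "x \<in> space (lebesgue_on_coords I)" "y \<in> space (lebesgue_on_coords I)"
    have "x(i := s) \<in> space (lebesgue_on_coords (insert i I))" "y(i := t) \<in> space (lebesgue_on_coords (insert i I))"
      using xy by (auto simp: space_PiM PiE_iff extensional_def)
    from insert.prems(4)[OF this]
    have "f (x(i := s)) * g (y(i := t)) \<le> (h (\<lambda>j\<in>insert i I. ((x(i := s)) j + (y(i := t)) j) / 2))\<^sup>2" .
    also have "(\<lambda>j\<in>insert i I. ((x(i := s)) j + (y(i := t)) j) / 2) = (\<lambda>j\<in>I. (x j + y j) / 2)(i := (s + t) / 2)"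
      using insert.hyps(2) by (auto simp: fun_eq_iff)
    finally show "f (x(i := s)) * g (y(i := t)) \<le> (h ((\<lambda>j\<in>I. (x j + y j) / 2)(i := (s + t) / 2)))\<^sup>2" .
  qed (intro slices insert.prems)+
  show ?case
    unfolding slices(3)[OF insert.prems(1)] slices(3)[OF insert.prems(2)] slices(3)[OF insert.prems(3)]
    by (rule prekopa_leindler_real[OF slices(1) slices(1) slices(1)]) (intro mid insert.prems)+
qed

lemma nn_integral_coords_affine:
  fixes f :: "('i \<Rightarrow> real) \<Rightarrow> ennreal" and c :: real
  assumes "finite I" and c: "c \<noteq> 0" and "f \<in> borel_measurable (lebesgue_on_coords I)"
  shows "(\<integral>\<^sup>+x. f x \<partial>lebesgue_on_coords I)
    = ennreal (\<bar>c\<bar> ^ card I) * (\<integral>\<^sup>+x. f (\<lambda>i\<in>I. a i + c * x i) \<partial>lebesgue_on_coords I)"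
  using assms(1,3)
proof (induction I arbitrary: f)
  case empty
  then show ?case
    by (simp add: PiM_empty nn_integral_count_space_finite restrict_def)
next
  case (insert i I)
  note [measurable] = insert.prems
  note slices = nn_integral_coords_insert[OF insert.hyps]
  define g where "g = (\<lambda>x. f (\<lambda>j\<in>insert i I. a j + c * x j))"
  have [measurable]: "g \<in> borel_measurable (lebesgue_on_coords (insert i I))"
    unfolding g_def by measurable
  have "(\<integral>\<^sup>+x. f x \<partial>lebesgue_on_coords (insert i I))
     = (\<integral>\<^sup>+s. (\<integral>\<^sup>+x. f (x(i := s)) \<partial>lebesgue_on_coords I) \<partial>lborel)"
    by (rule slices(3)) fact
  also have "\<dots> = ennreal \<bar>c\<bar> * (\<integral>\<^sup>+s. (\<integral>\<^sup>+x. f (x(i := a i + c * s)) \<partial>lebesgue_on_coords I) \<partial>lborel)"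
    by (rule nn_integral_real_affine[OF slices(1) c]) fact
  also have "(\<integral>\<^sup>+s. (\<integral>\<^sup>+x. f (x(i := a i + c * s)) \<partial>lebesgue_on_coords I) \<partial>lborel)
     = (\<integral>\<^sup>+s. ennreal (\<bar>c\<bar> ^ card I) * (\<integral>\<^sup>+x. g (x(i := s)) \<partial>lebesgue_on_coords I) \<partial>lborel)"
  proof (intro nn_integral_cong)
    fix s
    have "(\<integral>\<^sup>+x. f (x(i := a i + c * s)) \<partial>lebesgue_on_coords I)
       = ennreal (\<bar>c\<bar> ^ card I) * (\<integral>\<^sup>+x. f ((\<lambda>j\<in>I. a j + c * x j)(i := a i + c * s)) \<partial>lebesgue_on_coords I)"
      by (rule insert.IH) (intro slices insert.prems)
    moreover have "(\<lambda>j\<in>I. a j + c * x j)(i := a i + c * s) = (\<lambda>j\<in>insert i I. a j + c * (x(i := s)) j)" for x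
      using insert.hyps(2) by (auto simp: fun_eq_iff)
    ultimately show "(\<integral>\<^sup>+x. f (x(i := a i + c * s)) \<partial>lebesgue_on_coords I)
       = ennreal (\<bar>c\<bar> ^ card I) * (\<integral>\<^sup>+x. g (x(i := s)) \<partial>lebesgue_on_coords I)" by (simp add: g_def)
  qed
  also have "\<dots> = ennreal (\<bar>c\<bar> ^ card I) * (\<integral>\<^sup>+s. (\<integral>\<^sup>+x. g (x(i := s)) \<partial>lebesgue_on_coords I) \<partial>lborel)"
    using slices(1)[of g] by (intro nn_integral_cmult) simp
  also have "(\<integral>\<^sup>+s. (\<integral>\<^sup>+x. g (x(i := s)) \<partial>lebesgue_on_coords I) \<partial>lborel) = (\<integral>\<^sup>+x. g x \<partial>lebesgue_on_coords (insert i I))"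
    by (rule slices(3)[symmetric]) measurable
  finally show ?case
    using insert.hyps by (simp add: g_def ennreal_mult mult.assoc del: restrict_apply)
qed

section \<open>Balls, cones and the isodiametric inequality\<close>

definition dot :: "'i set \<Rightarrow> ('i \<Rightarrow> real) \<Rightarrow> ('i \<Rightarrow> real) \<Rightarrow> real" where
  "dot I x y = (\<Sum>i\<in>I. x i * y i)"

definition coord_ball :: "'i set \<Rightarrow> real \<Rightarrow> ('i \<Rightarrow> real) set" where
  "coord_ball I r = {x \<in> space (lebesgue_on_coords I). dot I x x < r\<^sup>2}"

lemma dot_self_nonneg: "0 \<le> dot I x x"
  by (simp add: dot_def sum_nonneg)

lemma dot_commute: "dot I x y = dot I y x"
  by (simp add: dot_def mult.commute)

lemma dot_restrict [simp]: "dot I (restrict x I) y = dot I x y" "dot I x (restrict y I) = dot I x y"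
  by (simp_all add: dot_def)

lemma dot_linear:
  "dot I (\<lambda>i. x i + y i) z = dot I x z + dot I y z" "dot I z (\<lambda>i. x i + y i) = dot I z x + dot I z y"
  "dot I (\<lambda>i. x i - y i) z = dot I x z - dot I y z" "dot I z (\<lambda>i. x i - y i) = dot I z x - dot I z y"
  "dot I (\<lambda>i. c * x i) z = c * dot I x z" "dot I z (\<lambda>i. c * x i) = c * dot I z x"
  "dot I (\<lambda>i. x i / c) z = dot I x z / c" "dot I z (\<lambda>i. x i / c) = dot I z x / c"
  "dot I (\<lambda>i. - x i) z = - dot I x z" "dot I z (\<lambda>i. - x i) = - dot I z x"
  by (simp_all add: dot_def sum.distrib sum_subtractf sum_distrib_left sum_divide_distrib sum_negf algebra_simps)

lemma dot_cauchy_schwarz: "(dot I x y)\<^sup>2 \<le> dot I x x * dot I y y"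
  unfolding dot_def using Cauchy_Schwarz_ineq_sum[of x y I] by (simp add: power2_eq_square)

lemma measurable_dot [measurable]:
  assumes "\<And>i. i \<in> I \<Longrightarrow> (\<lambda>x. f x i) \<in> borel_measurable M" "\<And>i. i \<in> I \<Longrightarrow> (\<lambda>x. g x i) \<in> borel_measurable M"
  shows "(\<lambda>x. dot I (f x) (g x)) \<in> borel_measurable M"
  unfolding dot_def using assms by measurable

lemma sets_coord_ball [measurable]: "coord_ball I r \<in> sets (lebesgue_on_coords I)"
  unfolding coord_ball_def by measurable

lemma measure_coords_affine:
  fixes c :: real
  assumes fin: "finite I" and c: "c \<noteq> 0" and S[measurable]: "S \<in> sets (lebesgue_on_coords I)"
  shows "measure (lebesgue_on_coords I) S
    = \<bar>c\<bar> ^ card I * measure (lebesgue_on_coords I)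
        {x \<in> space (lebesgue_on_coords I). (\<lambda>i\<in>I. a i + c * x i) \<in> S}"
    and "{x \<in> space (lebesgue_on_coords I). (\<lambda>i\<in>I. a i + c * x i) \<in> S} \<in> sets (lebesgue_on_coords I)"
proof -
  show meas: "{x \<in> space (lebesgue_on_coords I). (\<lambda>i\<in>I. a i + c * x i) \<in> S} \<in> sets (lebesgue_on_coords I)"
    by measurable
  have "emeasure (lebesgue_on_coords I) S = (\<integral>\<^sup>+x. indicator S x \<partial>lebesgue_on_coords I)" by simp
  also have "\<dots> = ennreal (\<bar>c\<bar> ^ card I)
      * (\<integral>\<^sup>+x. indicator S (\<lambda>i\<in>I. a i + c * x i) \<partial>lebesgue_on_coords I)"
    by (rule nn_integral_coords_affine[OF fin c]) measurable
  also have "(\<integral>\<^sup>+x. indicator S (\<lambda>i\<in>I. a i + c * x i) \<partial>lebesgue_on_coords I)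
    = (\<integral>\<^sup>+x. indicator {x \<in> space (lebesgue_on_coords I). (\<lambda>i\<in>I. a i + c * x i) \<in> S} x \<partial>lebesgue_on_coords I)"
    by (intro nn_integral_cong) (auto simp: indicator_def)
  finally have "emeasure (lebesgue_on_coords I) S = ennreal (\<bar>c\<bar> ^ card I)
      * emeasure (lebesgue_on_coords I) {x \<in> space (lebesgue_on_coords I). (\<lambda>i\<in>I. a i + c * x i) \<in> S}"
    using meas by simp
  then show "measure (lebesgue_on_coords I) S
    = \<bar>c\<bar> ^ card I * measure (lebesgue_on_coords I)
        {x \<in> space (lebesgue_on_coords I). (\<lambda>i\<in>I. a i + c * x i) \<in> S}"
    by (simp add: measure_def enn2real_mult)
qed

lemma coord_ball_fmeasurable:
  assumes fin: "finite I"
  shows "coord_ball I r \<in> fmeasurable (lebesgue_on_coords I)"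
proof (rule fmeasurableI2)
  have "emeasure (lebesgue_on_coords I) (PiE I (\<lambda>_. {-\<bar>r\<bar>..\<bar>r\<bar>})) = (\<Prod>i\<in>I. emeasure lborel {-\<bar>r\<bar>..\<bar>r\<bar>})"
    using fin by (intro lborel_product.emeasure_PiM) auto
  also have "\<dots> < \<infinity>" by (simp add: power_less_top_ennreal)
  finally show "PiE I (\<lambda>_. {-\<bar>r\<bar>..\<bar>r\<bar>}) \<in> fmeasurable (lebesgue_on_coords I)"
    using fin by (intro fmeasurableI sets_PiM_I_finite) auto
  show "coord_ball I r \<subseteq> PiE I (\<lambda>_. {-\<bar>r\<bar>..\<bar>r\<bar>})"
  proof
    fix x assume x: "x \<in> coord_ball I r"
    have "\<bar>x i\<bar> \<le> \<bar>r\<bar>" if "i \<in> I" for i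
    proof -
      have "(x i)\<^sup>2 \<le> dot I x x" unfolding dot_def power2_eq_square
        using that fin by (intro member_le_sum[of i I "\<lambda>i. x i * x i"]) auto
      then have "(x i)\<^sup>2 \<le> r\<^sup>2" using x by (simp add: coord_ball_def)
      then show ?thesis by (simp add: abs_le_square_iff)
    qed
    then show "x \<in> PiE I (\<lambda>_. {-\<bar>r\<bar>..\<bar>r\<bar>})" using x
      by (auto simp: coord_ball_def space_PiM PiE_iff abs_le_iff minus_le_iff)
  qed
qed simp

lemma fmeasurable_in_coord_ball:
  assumes "finite I" "S \<subseteq> coord_ball I r" "S \<in> sets (lebesgue_on_coords I)"
  shows "S \<in> fmeasurable (lebesgue_on_coords I)"
  using fmeasurableI2[OF coord_ball_fmeasurable] assms by blast

lemma measure_coord_ball: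
  assumes fin: "finite I" and r: "0 < r"
  shows "measure (lebesgue_on_coords I) (coord_ball I r)
    = r ^ card I * measure (lebesgue_on_coords I) (coord_ball I 1)"
proof -
  have "{x \<in> space (lebesgue_on_coords I). (\<lambda>i\<in>I. 0 + r * x i) \<in> coord_ball I r} = coord_ball I 1"
    using r by (auto simp: coord_ball_def space_PiM dot_linear power2_eq_square)
  then show ?thesis
    using measure_coords_affine(1)[OF fin, of r "coord_ball I r" "\<lambda>_. 0"] r by simp
qed

lemma measure_coord_ball_pos:
  assumes fin: "finite I"
  shows "0 < measure (lebesgue_on_coords I) (coord_ball I 1)"
proof -
  define d where "d = 1 / (real (card I) + 1)"
  have d: "0 < d" "d \<le> 1" "real (card I) * d < 1" by (auto simp: d_def field_simps)
  have "PiE I (\<lambda>_. {-d..d}) \<subseteq> coord_ball I 1"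
  proof
    fix x assume x: "x \<in> PiE I (\<lambda>_. {-d..d})"
    have "x i * x i \<le> d" if "i \<in> I" for i
    proof -
      have "\<bar>x i\<bar> \<le> d" using x that by (auto simp: PiE_iff abs_le_iff minus_le_iff)
      then have "\<bar>x i\<bar> * \<bar>x i\<bar> \<le> d * 1" using d by (intro mult_mono) auto
      then show ?thesis by simp
    qed
    then have "dot I x x \<le> real (card I) * d" unfolding dot_def by (rule sum_bounded_above)
    with d x show "x \<in> coord_ball I 1" by (auto simp: coord_ball_def space_PiM PiE_iff)
  qed
  then have "measure (lebesgue_on_coords I) (PiE I (\<lambda>_. {-d..d})) \<le> measure (lebesgue_on_coords I) (coord_ball I 1)"
    using fin by (intro measure_mono_fmeasurable coord_ball_fmeasurable sets_PiM_I_finite) auto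
  moreover have "emeasure (lebesgue_on_coords I) (PiE I (\<lambda>_. {-d..d})) = (\<Prod>i\<in>I. emeasure lborel {-d..d})"
    using fin by (intro lborel_product.emeasure_PiM) auto
  then have "emeasure (lebesgue_on_coords I) (PiE I (\<lambda>_. {-d..d})) = ennreal ((2 * d) ^ card I)"
    using d by (simp add: ennreal_power)
  then have "measure (lebesgue_on_coords I) (PiE I (\<lambda>_. {-d..d})) = (2 * d) ^ card I"
    using d by (simp add: measure_def)
  ultimately show ?thesis using d by (smt (verit) zero_less_power)
qed

text \<open>Bieberbach's inequality, by symmetrisation: every midpoint of \<open>K\<close> and \<open>- K\<close> is half a difference
  of points of \<open>K\<close>, hence lies in the ball of radius \<open>s\<close>.  By Prekopa--Leindler the volume of that ball
  is at least the geometric mean of the volumes of \<open>K\<close> and \<open>- K\<close>, which are equal.\<close>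

lemma isodiametric_inequality:
  assumes fin: "finite I" and K[measurable]: "K \<in> sets (lebesgue_on_coords I)" and KB: "K \<subseteq> coord_ball I r"
    and s: "0 < s"
    and diam: "\<And>x y. x \<in> K \<Longrightarrow> y \<in> K \<Longrightarrow> dot I (\<lambda>i. x i - y i) (\<lambda>i. x i - y i) < (2 * s)\<^sup>2"
  shows "measure (lebesgue_on_coords I) K \<le> s ^ card I * measure (lebesgue_on_coords I) (coord_ball I 1)"
proof -
  let ?M = "lebesgue_on_coords I"
  define L where "L = {x \<in> space ?M. (\<lambda>i\<in>I. 0 + (-1) * x i) \<in> K}"
  have L[measurable]: "L \<in> sets ?M" and KL: "measure ?M K = measure ?M L"
    using measure_coords_affine[OF fin _ K, of "-1" "\<lambda>_. 0"] by (simp_all add: L_def)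
  have "L \<subseteq> coord_ball I r"
    using KB by (auto simp: L_def coord_ball_def dot_linear)
  then have fm: "K \<in> fmeasurable ?M" "L \<in> fmeasurable ?M"
    using fmeasurable_in_coord_ball[OF fin _ K] fmeasurable_in_coord_ball[OF fin _ L] KB by auto
  have "(\<integral>\<^sup>+x. indicator K x \<partial>?M) * (\<integral>\<^sup>+x. indicator L x \<partial>?M) \<le> (\<integral>\<^sup>+x. indicator (coord_ball I s) x \<partial>?M)\<^sup>2"
  proof (rule prekopa_leindler[OF fin])
    fix x y assume xy: "x \<in> space ?M" "y \<in> space ?M"
    have "(\<lambda>i\<in>I. (x i + y i) / 2) \<in> coord_ball I s" if "x \<in> K" "y \<in> L"
    proof -
      have "(\<lambda>i\<in>I. - y i) \<in> K" using that by (simp add: L_def)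
      from diam[OF that(1) this]
      have "dot I (\<lambda>i. x i + y i) (\<lambda>i. x i + y i) < (2 * s)\<^sup>2"
        by (simp add: dot_def)
      then show ?thesis
        by (simp add: coord_ball_def space_PiM dot_linear(7,8) power2_eq_square)
    qed
    then show "indicator K x * indicator L y \<le> ((indicator (coord_ball I s) (\<lambda>i\<in>I. (x i + y i) / 2))\<^sup>2 :: ennreal)"
      by (auto simp: indicator_def)
  qed measurable
  then have "emeasure ?M K * emeasure ?M L \<le> (emeasure ?M (coord_ball I s))\<^sup>2" by simp
  then have "(measure ?M K)\<^sup>2 \<le> (measure ?M (coord_ball I s))\<^sup>2"
    using fm coord_ball_fmeasurable[OF fin, of s] KL
    by (simp add: emeasure_eq_measure2 power2_eq_square flip: ennreal_mult)
  then have "measure ?M K \<le> measure ?M (coord_ball I s)" by (rule power2_le_imp_le) simp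
  then show ?thesis using measure_coord_ball[OF fin s] by simp
qed

text \<open>With \<open>s = sin x\<close>, the angular hypothesis says that any two directions in \<open>K\<close> enclose an angle of at most
  \<open>2 x\<close>.  The extreme distances in a cone are attained between two tips (\<open>2 s\<close>) or between a tip and the
  apex (\<open>1\<close>), which is why \<open>s\<close> has to be at least one half.\<close>

lemma cone_isodiametric_inequality:
  assumes fin: "finite I" and K: "K \<in> sets (lebesgue_on_coords I)" and KB: "K \<subseteq> coord_ball I 1"
    and s: "1 / 2 \<le> s"
    and angle: "\<And>x y. x \<in> K \<Longrightarrow> y \<in> K \<Longrightarrow> (1 - 2 * s\<^sup>2) * (sqrt (dot I x x) * sqrt (dot I y y)) \<le> dot I x y"
  shows "measure (lebesgue_on_coords I) K \<le> s ^ card I * measure (lebesgue_on_coords I) (coord_ball I 1)"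
proof (rule isodiametric_inequality[OF fin K KB])
  fix x y assume xy: "x \<in> K" "y \<in> K"
  define a b where "a = sqrt (dot I x x)" and "b = sqrt (dot I y y)"
  have ab: "0 \<le> a" "a < 1" "0 \<le> b" "b < 1" and sq: "a\<^sup>2 = dot I x x" "b\<^sup>2 = dot I y y"
    using xy KB by (auto simp: a_def b_def coord_ball_def dot_self_nonneg)
  have s4: "1 \<le> 4 * s\<^sup>2" using power_mono[of "1/2" s 2] s by (simp add: power2_eq_square)
  have "dot I (\<lambda>i. x i - y i) (\<lambda>i. x i - y i) = a\<^sup>2 + b\<^sup>2 - 2 * dot I x y"
    by (simp add: dot_linear sq dot_commute[of I y x])
  also have "\<dots> \<le> a\<^sup>2 + b\<^sup>2 - 2 * ((1 - 2 * s\<^sup>2) * (a * b))"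
    using angle[OF xy] by (simp add: a_def b_def)
  also have "\<dots> = (a - b)\<^sup>2 + 4 * s\<^sup>2 * (a * b)" by (simp add: power2_eq_square algebra_simps)
  also have "\<dots> \<le> 4 * s\<^sup>2 * (a - b)\<^sup>2 + 4 * s\<^sup>2 * (a * b)"
    using mult_right_mono[OF s4, of "(a - b)\<^sup>2"] by simp
  also have "\<dots> = 4 * s\<^sup>2 * (a\<^sup>2 + b\<^sup>2 - a * b)" by (simp add: power2_eq_square algebra_simps)
  also have "\<dots> < 4 * s\<^sup>2 * 1"
  proof (rule mult_strict_left_mono)
    have "x\<^sup>2 + y\<^sup>2 - x * y < 1" if "0 \<le> y" "y \<le> x" "x < 1" for x y :: real
    proof -
      have "y * y \<le> x * y" using that by (intro mult_right_mono) auto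
      moreover have "x * x < 1 * 1" using that by (intro mult_strict_mono') auto
      ultimately show ?thesis by (simp add: power2_eq_square)
    qed
    from this[of b a] this[of a b] show "a\<^sup>2 + b\<^sup>2 - a * b < 1"
      using ab by (cases "b \<le> a") (auto simp: algebra_simps)
  qed (use s in simp)
  finally show "dot I (\<lambda>i. x i - y i) (\<lambda>i. x i - y i) < (2 * s)\<^sup>2" by (simp add: power2_eq_square)
qed (use s in simp)

text \<open>The ball of radius \<open>s = sin \<rho>\<close> about \<open>c q\<close>, \<open>c = cos \<rho>\<close>, is centred at the centre of the boundary of the
  cap of radius \<open>\<rho>\<close> about \<open>q\<close>, and this boundary is an
  equator of it.  In high dimension the volume of the ball concentrates near the hyperplane through
  its centre orthogonal to \<open>q\<close>, hence near that equator.  The slab \<open>W\<close> of thickness \<open>e\<close> on the far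
  side of this hyperplane lies in the cone and in a ball of radius \<open>sqrt (1 + 2 e)\<close>.  Compared with the
  half ball it lacks only a set that fits in a smaller ball, exponentially small in the dimension.\<close>

lemma cone_volume_lower_bound:
  fixes q :: "'i \<Rightarrow> real"
  assumes fin: "finite I" and q: "dot I q q = 1"
    and s: "0 < s" and c: "0 < c" and cs: "c\<^sup>2 + s\<^sup>2 = 1" and e: "0 < e" "e < s"
  shows "(1 / sqrt (1 + 2 * e)) ^ card I * (s ^ card I / 2 - sqrt (s\<^sup>2 - e\<^sup>2) ^ card I)
        * measure (lebesgue_on_coords I) (coord_ball I 1)
     \<le> measure (lebesgue_on_coords I) {z \<in> coord_ball I 1. c * sqrt (dot I z z) < dot I q z}"
proof -
  let ?M = "lebesgue_on_coords I"
  define R where "R = sqrt (1 + 2 * e)"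
  have R: "0 < R" "R\<^sup>2 = 1 + 2 * e" using e by (auto simp: R_def)
  have c2: "c\<^sup>2 \<le> 1" using cs by (smt (verit) zero_le_power2)
  have c1: "c \<le> 1" using cs s by (smt (verit) one_le_power zero_less_power)
  define C where "C = {z \<in> coord_ball I 1. c * sqrt (dot I z z) < dot I q z}"
  have [measurable]: "C \<in> sets ?M"
  proof -
    have "C = {z \<in> space ?M. z \<in> coord_ball I 1 \<and> c * sqrt (dot I z z) < dot I q z}"
      by (auto simp: C_def coord_ball_def)
    also have "\<dots> \<in> sets ?M" by measurable
    finally show ?thesis .
  qed
  define W where "W = {w \<in> coord_ball I s. 0 \<le> dot I q w \<and> dot I q w < e}"
  define H H' where "H = {w \<in> coord_ball I s. 0 \<le> dot I q w}" and "H' = {w \<in> coord_ball I s. dot I q w \<le> 0}"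
  define F where "F = {w \<in> coord_ball I s. e \<le> dot I q w}"
  have meas: "{w \<in> coord_ball I s. P (dot I q w)} \<in> sets ?M" if [measurable]: "Measurable.pred borel P" for P
  proof -
    have "{w \<in> coord_ball I s. P (dot I q w)} = {w \<in> space ?M. w \<in> coord_ball I s \<and> P (dot I q w)}"
      by (auto simp: coord_ball_def)
    also have "\<dots> \<in> sets ?M" by measurable
    finally show ?thesis .
  qed
  have [measurable]: "W \<in> sets ?M" "H \<in> sets ?M" "H' \<in> sets ?M" "F \<in> sets ?M"
    unfolding W_def H_def H'_def F_def by (rule meas, measurable)+
  have fm: "W \<in> fmeasurable ?M" "H \<in> fmeasurable ?M" "H' \<in> fmeasurable ?M" "F \<in> fmeasurable ?M" "C \<in> fmeasurable ?M"
    by (rule fmeasurable_in_coord_ball[OF fin, of _ s] fmeasurable_in_coord_ball[OF fin, of _ 1];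
        force simp: W_def H_def H'_def F_def C_def)+
  have "measure ?M H = measure ?M H'"
  proof -
    have "{x \<in> space ?M. (\<lambda>i\<in>I. 0 + (-1) * x i) \<in> H} = H'"
      by (auto simp: H_def H'_def coord_ball_def dot_linear space_PiM)
    then show ?thesis using measure_coords_affine(1)[OF fin, of "-1" H "\<lambda>_. 0"] by simp
  qed
  moreover have "measure ?M (coord_ball I s) \<le> measure ?M (H \<union> H')"
    using fm by (intro measure_mono_fmeasurable fmeasurable.Un) (auto simp: H_def H'_def)
  moreover have "measure ?M (H \<union> H') \<le> measure ?M H + measure ?M H'"
    by (rule measure_Un_le) auto
  ultimately have half: "s ^ card I * measure ?M (coord_ball I 1) \<le> 2 * measure ?M H"
    using measure_coord_ball[OF fin s] by simp
  have "measure ?M F \<le> sqrt (s\<^sup>2 - e\<^sup>2) ^ card I * measure ?M (coord_ball I 1)"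
  proof -
    define t where "t = sqrt (s\<^sup>2 - e\<^sup>2)"
    have "e\<^sup>2 < s\<^sup>2" using e by (intro power_strict_mono) auto
    then have t: "0 < t" "t\<^sup>2 = s\<^sup>2 - e\<^sup>2" by (auto simp: t_def)
    define F' where "F' = {x \<in> space ?M. (\<lambda>i\<in>I. e * q i + 1 * x i) \<in> F}"
    have F': "F' \<in> sets ?M" "measure ?M F = measure ?M F'"
      using measure_coords_affine[OF fin, of 1 F "\<lambda>i. e * q i"] by (simp_all add: F'_def)
    have "F' \<subseteq> coord_ball I t"
    proof
      fix x assume x: "x \<in> F'"
      have "dot I (\<lambda>i. e * q i + 1 * x i) (\<lambda>i. e * q i + 1 * x i) = dot I x x + 2 * e * dot I q x + e\<^sup>2"
        using q by (simp add: dot_linear dot_commute[of I x q] power2_eq_square algebra_simps)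
      moreover have "dot I q (\<lambda>i. e * q i + 1 * x i) = e + dot I q x"
        using q by (simp add: dot_linear)
      ultimately have "dot I x x + 2 * e * dot I q x + e\<^sup>2 < s\<^sup>2" "0 \<le> dot I q x"
        using x by (simp_all add: F'_def F_def coord_ball_def del: mult_1)
      moreover from this have "0 \<le> 2 * e * dot I q x" using e by simp
      ultimately have "dot I x x < s\<^sup>2 - e\<^sup>2" by linarith
      then show "x \<in> coord_ball I t" using x t by (simp add: F'_def coord_ball_def)
    qed
    then have "measure ?M F' \<le> measure ?M (coord_ball I t)"
      using F'(1) by (intro measure_mono_fmeasurable coord_ball_fmeasurable fin) auto
    then show ?thesis using F'(2) measure_coord_ball[OF fin t(1)] by (simp add: t_def)
  qed
  moreover have "measure ?M H \<le> measure ?M W + measure ?M F"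
  proof -
    have "measure ?M H \<le> measure ?M (W \<union> F)"
      using fm by (intro measure_mono_fmeasurable fmeasurable.Un) (auto simp: H_def W_def F_def)
    also have "\<dots> \<le> measure ?M W + measure ?M F" by (rule measure_Un_le) auto
    finally show ?thesis .
  qed
  ultimately have W: "(s ^ card I / 2 - sqrt (s\<^sup>2 - e\<^sup>2) ^ card I) * measure ?M (coord_ball I 1) \<le> measure ?M W"
    using half by (simp add: algebra_simps)
  (* W, moved back to the centre c q and rescaled by 1/R to fit into the unit ball. *)
  define W' where "W' = {x \<in> space ?M. (\<lambda>i\<in>I. - c * q i + R * x i) \<in> W}"
  have W': "W' \<in> sets ?M" "measure ?M W = R ^ card I * measure ?M W'"
    using measure_coords_affine[OF fin, of R W "\<lambda>i. - c * q i"] R by (simp_all add: W'_def)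
  have "W' \<subseteq> C"
  proof
    fix x assume x: "x \<in> W'"
    define X Y where "X = dot I x x" and "Y = dot I q x"
    have "dot I (\<lambda>i. - c * q i + R * x i) (\<lambda>i. - c * q i + R * x i) = R\<^sup>2 * X - 2 * c * (R * Y) + c\<^sup>2"
      using q by (simp add: X_def Y_def dot_linear dot_commute[of I x q] power2_eq_square algebra_simps)
    moreover have "dot I q (\<lambda>i. - c * q i + R * x i) = R * Y - c"
      using q by (simp add: dot_linear Y_def)
    ultimately have w: "R\<^sup>2 * X - 2 * c * (R * Y) + c\<^sup>2 < s\<^sup>2" "0 \<le> R * Y - c" "R * Y - c < e"
      using x by (simp_all add: W'_def W_def coord_ball_def)
    define \<tau> where "\<tau> = R * Y - c"
    have RX: "R\<^sup>2 * X < 1 + 2 * c * \<tau>"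
      using w(1) cs by (simp add: \<tau>_def power2_eq_square algebra_simps)
    have "c * \<tau> \<le> 1 * \<tau>" using w c1 by (intro mult_right_mono) (auto simp: \<tau>_def)
    with RX have "R\<^sup>2 * X < R\<^sup>2 * 1" using w(3) R(2) by (simp add: \<tau>_def)
    then have X1: "X < 1" using R(1) by (simp add: mult_less_cancel_left_pos)
    have "c\<^sup>2 * (R\<^sup>2 * X) < c\<^sup>2 * (1 + 2 * c * \<tau>)" using RX c by (intro mult_strict_left_mono) auto
    also have "\<dots> = c\<^sup>2 + 2 * c * (c\<^sup>2 * \<tau>)" by (simp add: power2_eq_square algebra_simps)
    also have "\<dots> \<le> c\<^sup>2 + 2 * c * (1 * \<tau>)"
      using c2 w c by (intro add_left_mono mult_left_mono mult_right_mono) (auto simp: \<tau>_def)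
    also have "\<dots> \<le> (c + \<tau>)\<^sup>2" by (simp add: power2_eq_square algebra_simps)
    also have "\<dots> = (R * Y)\<^sup>2" by (simp add: \<tau>_def)
    finally have "(c * (R * sqrt X))\<^sup>2 < (R * Y)\<^sup>2"
      using dot_self_nonneg[of I x] by (simp add: X_def power_mult_distrib)
    then have "c * (R * sqrt X) < R * Y" by (rule power_less_imp_less_base) (use w c in auto)
    then have "R * (c * sqrt X) < R * Y" by (simp add: mult_ac)
    then have "c * sqrt X < Y" using R(1) by (simp add: mult_less_cancel_left_pos)
    with X1 show "x \<in> C" using x by (simp add: C_def coord_ball_def W'_def X_def Y_def)
  qed
  then have "measure ?M W' \<le> measure ?M C"
    using W'(1) fm by (intro measure_mono_fmeasurable) auto
  moreover have "measure ?M W' = (1 / R) ^ card I * measure ?M W"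
    using W'(2) R(1) by (simp add: power_one_over)
  moreover have "(1 / R) ^ card I * ((s ^ card I / 2 - sqrt (s\<^sup>2 - e\<^sup>2) ^ card I) * measure ?M (coord_ball I 1))
      \<le> (1 / R) ^ card I * measure ?M W"
    using W R(1) by (intro mult_left_mono) auto
  ultimately show ?thesis by (simp add: R_def C_def mult.assoc)
qed

section \<open>The volume obstruction to correspondences between spheres\<close>

lemma topspace_nsphere_iff:
  "x \<in> topspace (nsphere m) \<longleftrightarrow> dot {..m} x x = 1 \<and> (\<forall>i>m. x i = 0)"
  by (simp add: nsphere dot_def power2_eq_square)

lemma sphere_dist_eq_arccos_dot: "sphere_dist m x y = arccos (dot {..m} x y)"
  by (simp add: sphere_dist_def dot_def)

lemma dot_unit_bounds:
  assumes "dot I x x = 1" "dot I y y = 1"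
  shows "-1 \<le> dot I x y" "dot I x y \<le> 1"
  using dot_cauchy_schwarz[of I x y] assms by (auto simp: abs_square_le_1 abs_le_iff)

lemma sphere_dist_bounds:
  assumes "x \<in> topspace (nsphere m)" "y \<in> topspace (nsphere m)"
  shows "0 \<le> sphere_dist m x y" "sphere_dist m x y \<le> pi" "cos (sphere_dist m x y) = dot {..m} x y"
  using dot_unit_bounds[of "{..m}" x y] assms
  by (auto simp: topspace_nsphere_iff sphere_dist_eq_arccos_dot arccos_lbound arccos_ubound)

text \<open>Two points of a cap of radius \<open>\<rho>\<close> are at distance at most \<open>2 \<rho>\<close>; for \<open>c = cos \<rho>\<close> the bound is \<open>cos (2 \<rho>)\<close>.
  It follows from the Cauchy--Schwarz inequality for \<open>Q + Q'\<close> and \<open>z\<close>.\<close>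

lemma dot_in_common_cap:
  assumes Q: "dot I Q Q = 1" "dot I Q' Q' = 1" and c: "0 \<le> c"
    and z: "c * sqrt (dot I z z) < dot I Q z" "c * sqrt (dot I z z) < dot I Q' z"
  shows "2 * c\<^sup>2 - 1 \<le> dot I Q Q'"
proof -
  define Z where "Z = dot I z z"
  have "Z \<noteq> 0"
  proof
    assume "Z = 0"
    then show False using z dot_cauchy_schwarz[of I Q z] by (simp add: Z_def)
  qed
  then have Z: "0 < Z" using dot_self_nonneg[of I z] by (simp add: Z_def)
  have "(2 * (c * sqrt Z))\<^sup>2 \<le> (dot I (\<lambda>i. Q i + Q' i) z)\<^sup>2"
    using z c Z by (intro power_mono) (auto simp: dot_linear Z_def)
  also have "\<dots> \<le> dot I (\<lambda>i. Q i + Q' i) (\<lambda>i. Q i + Q' i) * Z"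
    unfolding Z_def by (rule dot_cauchy_schwarz)
  also have "dot I (\<lambda>i. Q i + Q' i) (\<lambda>i. Q i + Q' i) = 2 + 2 * dot I Q Q'"
    using Q by (simp add: dot_linear dot_commute[of I Q' Q])
  finally have "(4 * c\<^sup>2) * Z \<le> (2 + 2 * dot I Q Q') * Z"
    using Z by (simp add: power_mult_distrib)
  then show ?thesis using Z by (simp add: mult_le_cancel_right_pos)
qed

lemma dot_perturbation:
  assumes "\<And>i. i \<in> I \<Longrightarrow> \<bar>u i - p i\<bar> \<le> e" "\<And>i. i \<in> I \<Longrightarrow> \<bar>u' i - p' i\<bar> \<le> e"
    and "\<And>i. i \<in> I \<Longrightarrow> \<bar>u i\<bar> \<le> 1" "\<And>i. i \<in> I \<Longrightarrow> \<bar>p' i\<bar> \<le> 1"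
  shows "dot I p p' - 2 * real (card I) * e \<le> dot I u u'"
proof -
  have "p i * p' i - u i * u' i \<le> 2 * e" if "i \<in> I" for i
  proof -
    have "p i * p' i - u i * u' i = (p i - u i) * p' i + u i * (p' i - u' i)"
      by (simp add: algebra_simps)
    also have "\<dots> \<le> \<bar>u i - p i\<bar> * \<bar>p' i\<bar> + \<bar>u i\<bar> * \<bar>u' i - p' i\<bar>"
      using abs_ge_self[of "(p i - u i) * p' i"] abs_ge_self[of "u i * (p' i - u' i)"]
      by (simp add: abs_mult abs_minus_commute)
    also have "\<dots> \<le> e * 1 + 1 * e" using assms that abs_ge_zero[of "u i - p i"]
      by (intro add_mono mult_mono) (auto intro: order_trans[OF abs_ge_zero])
    finally show ?thesis by simp
  qed
  then have "(\<Sum>i\<in>I. p i * p' i - u i * u' i) \<le> real (card I) * (2 * e)"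
    by (rule sum_bounded_above)
  then show ?thesis by (simp add: dot_def sum_subtractf algebra_simps)
qed

text \<open>The origin is invariant under scaling by 2, which multiplies volumes by a power of 2.\<close>

lemma measure_origin:
  assumes fin: "finite I" and ne: "I \<noteq> {}"
  shows "{x \<in> space (lebesgue_on_coords I). dot I x x = 0} \<in> sets (lebesgue_on_coords I)"
    and "measure (lebesgue_on_coords I) {x \<in> space (lebesgue_on_coords I). dot I x x = 0} = 0"
proof -
  let ?M = "lebesgue_on_coords I"
  let ?Z = "{x \<in> space ?M. dot I x x = 0}"
  show Z: "?Z \<in> sets ?M" by measurable
  have "{x \<in> space ?M. (\<lambda>i\<in>I. 0 + 2 * x i) \<in> ?Z} = ?Z" by (auto simp: dot_linear space_PiM)
  then have "measure ?M ?Z = 2 ^ card I * measure ?M ?Z"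
    using measure_coords_affine(1)[OF fin _ Z, of 2 "\<lambda>_. 0"] by simp
  moreover have "1 < (2::real) ^ card I" using fin ne by (intro one_less_power) (auto simp: card_gt_0_iff)
  ultimately show "measure ?M ?Z = 0" by simp
qed

lemma floor_eq_imp_close:
  fixes a b N :: real
  assumes "\<lfloor>N * a\<rfloor> = \<lfloor>N * b\<rfloor>" "0 < N"
  shows "\<bar>a - b\<bar> \<le> 1 / N"
proof -
  have "\<bar>N * a - N * b\<bar> \<le> 1" using assms(1) by linarith
  then have "N * \<bar>a - b\<bar> \<le> 1" using assms(2) by (simp add: abs_mult flip: right_diff_distrib)
  then show ?thesis using assms(2) by (simp add: field_simps)
qed

text \<open>A correspondence need not contain a measurable map, so the \<open>n\<close>-sphere is first cut into finitely many
  small cells, each of which is sent as a whole to a point that corresponds to one of its elements.  The union of the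
  cells sent into the cap about \<open>z\<close> is bounded by the isodiametric inequality.  Integration over \<open>z\<close> and
  exchange with the finite sum over the cells compares this bound with the volume of the cap.\<close>

lemma cap_volume_bound_of_correspondence:
  assumes corr: "correspondence (topspace (nsphere m)) (topspace (nsphere n)) R"
    and dis: "\<And>q p q' p'. (q, p) \<in> R \<Longrightarrow> (q', p') \<in> R \<Longrightarrow> \<bar>sphere_dist m q q' - sphere_dist n p p'\<bar> \<le> d"
    and \<rho>: "0 < \<rho>" "\<rho> < pi / 2" and x: "2 * \<rho> + d < 2 * x" "x < pi / 2" "1 / 2 \<le> sin x"
    and cone: "\<And>q. q \<in> topspace (nsphere m) \<Longrightarrow>
      \<kappa> * measure (lebesgue_on_coords {..m}) (coord_ball {..m} 1) \<le> measure (lebesgue_on_coords {..m})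
        {z \<in> coord_ball {..m} 1. cos \<rho> * sqrt (dot {..m} z z) < dot {..m} q z}"
  shows "\<kappa> \<le> sin x ^ Suc n"
proof -
  let ?I = "{..m}" and ?J = "{..n}"
  let ?MI = "lebesgue_on_coords ?I" and ?MJ = "lebesgue_on_coords ?J"
  let ?VI = "measure ?MI (coord_ball ?I 1)" and ?VJ = "measure ?MJ (coord_ball ?J 1)"
  define nrm where "nrm = (\<lambda>y::nat \<Rightarrow> real. sqrt (dot ?J y y))"
  define u where "u = (\<lambda>y i. if i \<le> n then y i / nrm y else 0)"
  have u_sphere: "u y \<in> topspace (nsphere n)" if "0 < dot ?J y y" for y
  proof -
    have "dot ?J (u y) (u y) = dot ?J (\<lambda>i. y i / nrm y) (\<lambda>i. y i / nrm y)"
      by (auto simp: dot_def u_def intro!: sum.cong)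
    also have "\<dots> = 1" using that by (simp add: dot_linear nrm_def)
    finally show ?thesis by (simp add: topspace_nsphere_iff u_def)
  qed
  have u_le: "\<bar>u y i\<bar> \<le> 1" if "0 < dot ?J y y" for y i
  proof (cases "i \<le> n")
    case True
    then have "u y i * u y i \<le> dot ?J (u y) (u y)" unfolding dot_def
      by (intro member_le_sum[of i ?J "\<lambda>i. u y i * u y i"]) auto
    then show ?thesis using u_sphere[OF that]
      by (simp add: topspace_nsphere_iff abs_square_le_1 flip: power2_eq_square)
  qed (simp add: u_def)
  have "0 \<le> d"
  proof -
    obtain q p where "(q, p) \<in> R" using corr in_topspace_nsphere[of m] by (auto simp: correspondence_def)
    from dis[OF this this] show ?thesis by simp
  qed
  then have "cos (2 * x) < cos (2 * \<rho> + d)" using x \<rho> by (intro cos_monotone_0_pi) auto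
  then obtain N0 where N0: "2 * real (Suc n) / (cos (2 * \<rho> + d) - cos (2 * x)) < real N0"
    using reals_Archimedean2 by blast
  (* Directions in one cell differ by at most 1/N per coordinate, which changes inner products by less
     than the margin left between 2 \<rho> + d and 2 x. *)
  define N where "N = Suc N0"
  have N: "2 * real (Suc n) * (1 / real N) \<le> cos (2 * \<rho> + d) - cos (2 * x)"
    using N0 \<open>cos (2 * x) < cos (2 * \<rho> + d)\<close> by (simp add: N_def field_simps)
  define cell where "cell = (\<lambda>k. {y \<in> coord_ball ?J 1. 0 < dot ?J y y \<and> (\<forall>i\<in>?J. \<lfloor>real N * u y i\<rfloor> = k i)})"
  have cell_sets[measurable]: "cell k \<in> sets ?MJ" for k
  proof -
    have "cell k = {y \<in> space ?MJ. y \<in> coord_ball ?J 1 \<and> 0 < dot ?J y y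
        \<and> (\<forall>i\<in>?J. \<lfloor>real N * (y i / sqrt (dot ?J y y))\<rfloor> = k i)}"
      by (auto simp: cell_def coord_ball_def u_def nrm_def)
    also have "\<dots> \<in> sets ?MJ" by measurable
    finally show ?thesis .
  qed
  define F where "F = {k \<in> PiE ?J (\<lambda>_. {- int N..int N}). cell k \<noteq> {}}"
  have finF: "finite F"
  proof -
    have "finite (PiE ?J (\<lambda>_. {- int N..int N}))" by (intro finite_PiE) auto
    then show ?thesis by (simp add: F_def)
  qed
  have cells: "(\<Union>k\<in>F. cell k) = {y \<in> coord_ball ?J 1. 0 < dot ?J y y}"
  proof (intro equalityI subsetI)
    fix y assume y: "y \<in> {y \<in> coord_ball ?J 1. 0 < dot ?J y y}"
    define k where "k = (\<lambda>i\<in>?J. \<lfloor>real N * u y i\<rfloor>)"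
    have yk: "y \<in> cell k" using y by (simp add: cell_def k_def)
    have "\<lfloor>real N * u y i\<rfloor> \<in> {- int N..int N}" for i
    proof -
      have "\<bar>real N * u y i\<bar> \<le> real N * 1" unfolding abs_mult
        using u_le[of y i] y by (intro mult_mono) auto
      then show ?thesis by (auto simp: abs_le_iff le_floor_iff floor_le_iff)
    qed
    then have "k \<in> F" using yk by (auto simp: F_def k_def)
    with yk show "y \<in> (\<Union>k\<in>F. cell k)" by blast
  qed (auto simp: cell_def)
  have disj: "disjoint_family_on cell F"
    unfolding disjoint_family_on_def
  proof (intro ballI impI)
    fix k l assume kl: "k \<in> F" "l \<in> F" "k \<noteq> l"
    have "\<exists>i\<in>?J. k i \<noteq> l i"
    proof (rule ccontr)
      assume "\<not> ?thesis"
      then have "k = l" using kl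
        by (intro PiE_ext[of k ?J "\<lambda>_. {- int N..int N}" l]) (auto simp: F_def)
      with kl show False by simp
    qed
    then show "cell k \<inter> cell l = {}" by (auto simp: cell_def)
  qed
  have "\<forall>k\<in>F. \<exists>y q. y \<in> cell k \<and> (q, u y) \<in> R"
  proof
    fix k assume "k \<in> F"
    then obtain y where y: "y \<in> cell k" by (auto simp: F_def)
    then have "u y \<in> topspace (nsphere n)" by (intro u_sphere) (auto simp: cell_def)
    then have "u y \<in> snd ` R" using corr by (simp add: correspondence_def)
    then obtain q where "(q, u y) \<in> R" by force
    with y show "\<exists>y q. y \<in> cell k \<and> (q, u y) \<in> R" by blast
  qed
  then obtain Y Q where YQ: "\<And>k. k \<in> F \<Longrightarrow> Y k \<in> cell k" "\<And>k. k \<in> F \<Longrightarrow> (Q k, u (Y k)) \<in> R"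
    by metis
  have Qs: "Q k \<in> topspace (nsphere m)" if "k \<in> F" for k
    using YQ(2)[OF that] corr by (auto simp: correspondence_def)
  have angle: "cos (2 * x) * (nrm y * nrm y') \<le> dot ?J y y'"
    if k: "k \<in> F" "k' \<in> F" "y \<in> cell k" "y' \<in> cell k'" and Q: "cos (2 * \<rho>) \<le> dot ?I (Q k) (Q k')" for k k' y y'
  proof -
    let ?p = "u (Y k)" and ?p' = "u (Y k')"
    have pos: "0 < dot ?J y y" "0 < dot ?J y' y'" "0 < dot ?J (Y k) (Y k)" "0 < dot ?J (Y k') (Y k')"
      using k YQ(1)[of k] YQ(1)[of k'] by (auto simp: cell_def)
    note b = sphere_dist_bounds[OF Qs Qs, OF k(1,2)]
    note b' = sphere_dist_bounds[OF u_sphere[OF pos(3)] u_sphere[OF pos(4)]]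
    have "sphere_dist m (Q k) (Q k') \<le> 2 * \<rho>"
    proof (rule ccontr)
      assume "\<not> ?thesis"
      then have "cos (sphere_dist m (Q k) (Q k')) < cos (2 * \<rho>)"
        using b \<rho> by (intro cos_monotone_0_pi) auto
      with Q b show False by simp
    qed
    then have "sphere_dist n ?p ?p' \<le> 2 * \<rho> + d"
      using dis[OF YQ(2) YQ(2), OF k(1,2)] by linarith
    then have "cos (2 * \<rho> + d) \<le> cos (sphere_dist n ?p ?p')"
      using b' x by (intro cos_monotone_0_pi_le) auto
    then have "cos (2 * \<rho> + d) \<le> dot ?J ?p ?p'" using b' by simp
    moreover have "dot ?J ?p ?p' - 2 * real (card ?J) * (1 / real N) \<le> dot ?J (u y) (u y')"
    proof (rule dot_perturbation)
      fix i assume i: "i \<in> ?J"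
      show "\<bar>u y i - ?p i\<bar> \<le> 1 / real N" using i k YQ(1)[OF k(1)]
        by (intro floor_eq_imp_close) (auto simp: cell_def N_def)
      show "\<bar>u y' i - ?p' i\<bar> \<le> 1 / real N" using i k YQ(1)[OF k(2)]
        by (intro floor_eq_imp_close) (auto simp: cell_def N_def)
    qed (use u_le pos in auto)
    ultimately have "cos (2 * x) \<le> dot ?J (u y) (u y')" using N by simp
    also have "dot ?J (u y) (u y') = dot ?J (\<lambda>i. y i / nrm y) (\<lambda>i. y' i / nrm y')"
      by (auto simp: dot_def u_def intro!: sum.cong)
    also have "\<dots> = dot ?J y y' / (nrm y * nrm y')" by (simp add: dot_linear)
    finally show ?thesis using pos by (simp add: nrm_def field_simps)
  qed
  define C where "C = (\<lambda>k. {z \<in> coord_ball ?I 1. cos \<rho> * sqrt (dot ?I z z) < dot ?I (Q k) z})"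
  have C_sets[measurable]: "C k \<in> sets ?MI" for k
  proof -
    have "C k = {z \<in> space ?MI. z \<in> coord_ball ?I 1 \<and> cos \<rho> * sqrt (dot ?I z z) < dot ?I (Q k) z}"
      by (auto simp: C_def coord_ball_def)
    also have "\<dots> \<in> sets ?MI" by measurable
    finally show ?thesis .
  qed
  have fmC: "C k \<in> fmeasurable ?MI" for k
    by (rule fmeasurable_in_coord_ball[OF _ _ C_sets, where r = 1]) (auto simp: C_def)
  have fmcell: "cell k \<in> fmeasurable ?MJ" for k
    by (rule fmeasurable_in_coord_ball[OF _ _ cell_sets, where r = 1]) (auto simp: cell_def)
  have fincell: "emeasure ?MJ (cell k) \<noteq> \<infinity>" for k
    using fmcell[of k] by (auto simp: fmeasurable_def)
  have UF: "(\<Union>k\<in>F. cell k) \<in> sets ?MJ" using finF cell_sets by (intro sets.finite_UN)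
  have total: "(\<Sum>k\<in>F. measure ?MJ (cell k)) = ?VJ"
  proof -
    have "(\<Sum>k\<in>F. measure ?MJ (cell k)) = measure ?MJ (\<Union>k\<in>F. cell k)"
      using cell_sets fincell by (intro measure_finite_Union[symmetric] finF disj) blast+
    moreover have "?VJ \<le> measure ?MJ ((\<Union>k\<in>F. cell k) \<union> {y \<in> space ?MJ. dot ?J y y = 0})"
    proof (rule measure_mono_fmeasurable)
      have "(\<Union>k\<in>F. cell k) \<union> {y \<in> space ?MJ. dot ?J y y = 0} \<subseteq> coord_ball ?J 1"
        by (auto simp: cell_def coord_ball_def)
      then show "(\<Union>k\<in>F. cell k) \<union> {y \<in> space ?MJ. dot ?J y y = 0} \<in> fmeasurable ?MJ"
        by (rule fmeasurable_in_coord_ball[rotated])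
           (auto intro!: sets.Un measure_origin UF)
      show "coord_ball ?J 1 \<subseteq> (\<Union>k\<in>F. cell k) \<union> {y \<in> space ?MJ. dot ?J y y = 0}"
        unfolding cells using dot_self_nonneg[of ?J] by (auto simp: coord_ball_def less_le)
    qed simp
    moreover have "measure ?MJ ((\<Union>k\<in>F. cell k) \<union> {y \<in> space ?MJ. dot ?J y y = 0})
        \<le> measure ?MJ (\<Union>k\<in>F. cell k) + measure ?MJ {y \<in> space ?MJ. dot ?J y y = 0}"
      by (intro measure_Un_le measure_origin UF) auto
    moreover have "measure ?MJ (\<Union>k\<in>F. cell k) \<le> ?VJ"
    proof (rule measure_mono_fmeasurable[OF _ UF])
      show "(\<Union>k\<in>F. cell k) \<subseteq> coord_ball ?J 1" by (auto simp: cell_def)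
    qed (simp add: coord_ball_fmeasurable)
    ultimately show ?thesis using measure_origin(2)[of ?J] by simp
  qed
  (* The left-hand side is the volume of the union of the cells that are sent into the cap about z. *)
  have slice: "(\<Sum>k\<in>F. measure ?MJ (cell k) * indicator (C k) z) \<le> sin x ^ Suc n * ?VJ * indicator (coord_ball ?I 1) z" for z
  proof (cases "z \<in> coord_ball ?I 1")
    case True
    define G where "G = {k \<in> F. z \<in> C k}"
    have "(\<Sum>k\<in>F. measure ?MJ (cell k) * indicator (C k) z) = (\<Sum>k\<in>G. measure ?MJ (cell k))"
      unfolding G_def sum.inter_filter[OF finF] by (intro sum.cong) (auto simp: indicator_def)
    also have "\<dots> = measure ?MJ (\<Union>k\<in>G. cell k)"
    proof (rule measure_finite_Union[symmetric])
      show "finite G" using finF by (simp add: G_def)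
      show "disjoint_family_on cell G" using disj by (rule disjoint_family_on_mono[rotated]) (auto simp: G_def)
    qed (use cell_sets fincell in blast)+
    also have "\<dots> \<le> sin x ^ card ?J * ?VJ"
    proof (rule cone_isodiametric_inequality)
      fix y y' assume "y \<in> (\<Union>k\<in>G. cell k)" "y' \<in> (\<Union>k\<in>G. cell k)"
      then obtain k k' where k: "k \<in> G" "k' \<in> G" "y \<in> cell k" "y' \<in> cell k'" by auto
      have "2 * (cos \<rho>)\<^sup>2 - 1 \<le> dot ?I (Q k) (Q k')"
        using k Qs[of k] Qs[of k'] \<rho>
        by (intro dot_in_common_cap[of _ _ _ _ z]) (auto simp: G_def C_def topspace_nsphere_iff cos_ge_zero)
      then have "cos (2 * \<rho>) \<le> dot ?I (Q k) (Q k')" by (simp add: cos_double_cos)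
      then have "cos (2 * x) * (nrm y * nrm y') \<le> dot ?J y y'"
        using k by (intro angle[of k k']) (auto simp: G_def)
      then show "(1 - 2 * (sin x)\<^sup>2) * (sqrt (dot ?J y y) * sqrt (dot ?J y' y')) \<le> dot ?J y y'"
        by (simp add: cos_double_sin nrm_def)
    next
      show "(\<Union>k\<in>G. cell k) \<in> sets ?MJ"
        using finF cell_sets by (intro sets.finite_UN) (simp_all add: G_def)
      show "(\<Union>k\<in>G. cell k) \<subseteq> coord_ball ?J 1" by (auto simp: cell_def)
    qed (use x in auto)
    finally show ?thesis using True by simp
  next
    case False
    then show ?thesis by (simp add: C_def)
  qed
  have "\<kappa> * ?VI * ?VJ = (\<Sum>k\<in>F. measure ?MJ (cell k) * (\<kappa> * ?VI))"
    by (simp add: sum_distrib_right[symmetric] total)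
  also have "\<dots> \<le> (\<Sum>k\<in>F. measure ?MJ (cell k) * measure ?MI (C k))"
    using cone Qs by (intro sum_mono mult_left_mono) (auto simp: C_def)
  also have "\<dots> = (\<integral>z. (\<Sum>k\<in>F. measure ?MJ (cell k) * indicator (C k) z) \<partial>?MI)"
    using fmC by (subst Bochner_Integration.integral_sum) (auto simp: fmeasurable_def Int_absorb1 sets.sets_into_space)
  also have "\<dots> \<le> (\<integral>z. sin x ^ Suc n * ?VJ * indicator (coord_ball ?I 1) z \<partial>?MI)"
    using fmC coord_ball_fmeasurable[of ?I 1]
    by (intro integral_mono slice Bochner_Integration.integrable_sum integrable_mult_right)
       (auto simp: fmeasurable_def)
  also have "\<dots> = sin x ^ Suc n * (?VI * ?VJ)"
    by (simp add: Int_absorb1 sets.sets_into_space[OF sets_coord_ball])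
  finally have "\<kappa> * (?VI * ?VJ) \<le> sin x ^ Suc n * (?VI * ?VJ)" by (simp add: mult_ac)
  then show ?thesis using measure_coord_ball_pos[of ?I] measure_coord_ball_pos[of ?J]
    by (simp add: mult_le_cancel_right_pos)
qed

section \<open>The topological threshold is asymptotically at most a right angle\<close>

text \<open>Within one closed simplex the weak topology is the product topology.\<close>

lemma continuous_map_into_simplex:
  assumes s: "s \<in> K" and f: "continuous_map X (powertop_real UNIV) f"
    and im: "\<And>x. x \<in> topspace X \<Longrightarrow> f x \<in> closed_simplex s"
  shows "continuous_map X (geometric_realization K) f"
  unfolding continuous_map_def
proof (intro conjI allI impI)
  show "f \<in> topspace X \<rightarrow> topspace (geometric_realization K)"
    using s im by (auto simp: topspace_geometric_realization)
  fix U assume "openin (geometric_realization K) U"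
  then have U: "openin (subtopology (powertop_real UNIV) (closed_simplex s)) (U \<inter> closed_simplex s)"
    using s by (simp add: openin_geometric_realization realization_open_def)
  have "continuous_map X (subtopology (powertop_real UNIV) (closed_simplex s)) f"
    using f im by (auto simp: continuous_map_in_subtopology)
  from openin_continuous_map_preimage[OF this U]
  have "openin X {x \<in> topspace X. f x \<in> U \<inter> closed_simplex s}" .
  also have "{x \<in> topspace X. f x \<in> U \<inter> closed_simplex s} = {x \<in> topspace X. f x \<in> U}"
    using im by auto
  finally show "openin X {x \<in> topspace X. f x \<in> U}" .
qed

lemma antipode_antipode [simp]: "antipode (antipode x) = x"
  by (simp add: antipode_def)

text \<open>The odd map sends \<open>x\<close> to the convex combination with weight \<open>\<bar>x\<^sub>i\<bar> / \<Sum>\<^sub>j \<bar>x\<^sub>j\<bar>\<close> on \<open>v\<^sub>i\<close> or on its antipode, according to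
  the sign of \<open>x\<^sub>i\<close>.  On each of the finitely many closed orthants of the sphere it takes values in a single
  simplex, so continuity can be checked there.\<close>

lemma c_threshold_le_of_almost_orthogonal:
  fixes v :: "nat \<Rightarrow> nat \<Rightarrow> real"
  assumes v: "\<And>i. i \<le> n \<Longrightarrow> v i \<in> topspace (nsphere m)"
    and orth: "\<And>i j. i \<le> n \<Longrightarrow> j \<le> n \<Longrightarrow> i \<noteq> j \<Longrightarrow> \<bar>dot {..m} (v i) (v j)\<bar> \<le> c"
    and c: "0 \<le> c" "c \<le> 1"
  shows "c_threshold m n \<le> arccos (- c)"
proof -
  define r where "r = arccos (- c)"
  define K where "K = VR_simplices (topspace (nsphere m)) (sphere_dist m) r"
  define S where "S = (\<lambda>x::nat \<Rightarrow> real. \<Sum>i\<le>n. \<bar>x i\<bar>)"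
  define f where "f = (\<lambda>(x::nat \<Rightarrow> real) y. (\<Sum>i\<le>n. (if y = v i then (\<bar>x i\<bar> + x i) / 2 else 0)
      + (if y = antipode (v i) then (\<bar>x i\<bar> - x i) / 2 else 0)) / S x)"
  define w where "w = (\<lambda>P i. if i \<in> P then v i else antipode (v i))"
  define T where "T = (\<lambda>P. {x \<in> topspace (nsphere n). (\<forall>i\<le>n. if i \<in> P then 0 \<le> x i else x i \<le> 0)})"
  have S_pos: "0 < S x" if "x \<in> topspace (nsphere n)" for x
  proof -
    have "\<exists>i\<le>n. x i \<noteq> 0"
    proof (rule ccontr)
      assume "\<not> ?thesis"
      then have "dot {..n} x x = 0" by (simp add: dot_def)
      with that show False by (simp add: topspace_nsphere_iff)
    qed
    then show ?thesis unfolding S_def by (auto intro!: sum_pos2)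
  qed
  have simplex: "w P ` {..n} \<in> K" for P
  proof -
    have "w P i \<in> topspace (nsphere m)" if "i \<le> n" for i
      using v[OF that] by (auto simp: w_def topspace_nsphere_iff antipode_def dot_linear)
    moreover have "sphere_dist m (w P i) (w P j) \<le> r" if ij: "i \<le> n" "j \<le> n" for i j
    proof -
      have "- c \<le> dot {..m} (w P i) (w P j)"
      proof (cases "i = j")
        case True
        then show ?thesis using v[OF ij(1)] c
          by (auto simp: w_def topspace_nsphere_iff antipode_def dot_linear)
      next
        case False
        then show ?thesis using orth[OF ij]
          by (auto simp: w_def antipode_def dot_linear abs_le_iff)
      qed
      then show ?thesis
        using c dot_unit_bounds(2)[of "{..m}" "w P i" "w P j"] calculation[OF ij(1)] calculation[OF ij(2)]
        by (auto simp: r_def sphere_dist_eq_arccos_dot topspace_nsphere_iff intro!: arccos_le_arccos)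
    qed
    ultimately show ?thesis by (auto simp: K_def VR_simplices_def)
  qed
  have f_T: "f x y = (\<Sum>i\<le>n. if y = w P i then \<bar>x i\<bar> else 0) / S x" if "x \<in> T P" for x y P
  proof -
    have "(if y = v i then (\<bar>x i\<bar> + x i) / 2 else 0) + (if y = antipode (v i) then (\<bar>x i\<bar> - x i) / 2 else 0)
       = (if y = w P i then \<bar>x i\<bar> else 0)" if "i \<le> n" for i
      using \<open>x \<in> T P\<close> that by (auto simp: T_def w_def)
    then show ?thesis by (simp add: f_def)
  qed
  have f_simplex: "f x \<in> closed_simplex (w P ` {..n})" if x: "x \<in> T P" for x P
  proof -
    have "(\<Sum>y\<in>w P ` {..n}. f x y) = (\<Sum>y\<in>w P ` {..n}. \<Sum>i\<le>n. if y = w P i then \<bar>x i\<bar> else 0) / S x"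
      by (simp add: f_T[OF x] sum_divide_distrib)
    also have "\<dots> = (\<Sum>i\<le>n. \<Sum>y\<in>w P ` {..n}. if y = w P i then \<bar>x i\<bar> else 0) / S x"
      by (subst sum.swap) simp
    also have "\<dots> = S x / S x" unfolding S_def by (simp add: sum.delta)
    also have "\<dots> = 1" using S_pos[of x] x by (simp add: T_def)
    finally have "(\<Sum>y\<in>w P ` {..n}. f x y) = 1" .
    moreover have "0 \<le> f x y" for y
      using S_pos[of x] x by (auto simp: f_T[OF x] T_def intro!: divide_nonneg_pos sum_nonneg)
    moreover have "f x y = 0" if "y \<notin> w P ` {..n}" for y
      using that by (auto simp: f_T[OF x] intro!: sum.neutral)
    ultimately show ?thesis by (simp add: closed_simplex_def)
  qed
  have cont_coord: "continuous_map (nsphere n) (powertop_real UNIV) f"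
    unfolding continuous_map_componentwise_UNIV
  proof
    fix y :: "nat \<Rightarrow> real"
    have "continuous_map (nsphere n) euclideanreal (\<lambda>x. if y = z then (\<bar>x i\<bar> + x i) / 2 else 0)"
      "continuous_map (nsphere n) euclideanreal (\<lambda>x. if y = z then (\<bar>x i\<bar> - x i) / 2 else 0)" for z i
      by (cases "y = z"; simp; intro continuous_intros continuous_map_nsphere_projection; simp)+
    then show "continuous_map (nsphere n) euclideanreal (\<lambda>x. f x y)"
      unfolding f_def using S_pos
      by (auto simp: S_def intro!: continuous_intros continuous_map_nsphere_projection simp: less_imp_neq[symmetric])
  qed
  have "continuous_map (nsphere n) (geometric_realization K) f"
  proof (rule pasting_lemma_closed[where I = "Pow {..n}" and T = T and f = "\<lambda>_. f"])
    fix P assume "P \<in> Pow {..n}"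
    have "closedin (nsphere n) (\<Inter>i\<in>{..n}. {x \<in> topspace (nsphere n). x i \<in> (if i \<in> P then {0..} else {..0})})"
      by (intro closedin_INT closedin_continuous_map_preimage[OF continuous_map_nsphere_projection]) auto
    also have "(\<Inter>i\<in>{..n}. {x \<in> topspace (nsphere n). x i \<in> (if i \<in> P then {0..} else {..0})}) = T P"
    proof -
      have "(t \<in> (if i \<in> P then {0..} else {..0})) = (if i \<in> P then 0 \<le> t else t \<le> 0)" for i and t :: real
        by simp
      then show ?thesis by (auto simp: T_def)
    qed
    finally show "closedin (nsphere n) (T P)" .
    show "continuous_map (subtopology (nsphere n) (T P)) (geometric_realization K) f"
      by (rule continuous_map_into_simplex[OF simplex[of P]])
         (auto intro: continuous_map_from_subtopology cont_coord f_simplex)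
  next
    fix x assume x: "x \<in> topspace (nsphere n)"
    then have "x \<in> T {i. i \<le> n \<and> 0 \<le> x i}" by (auto simp: T_def)
    then show "\<exists>P. P \<in> Pow {..n} \<and> x \<in> T P \<and> f x = f x" by (intro exI[of _ "{i. i \<le> n \<and> 0 \<le> x i}"]) auto
  qed auto
  moreover have "f (antipode x) = VR_antipode (f x)" for x
  proof
    fix y
    have *: "antipode y = z \<longleftrightarrow> y = antipode z" for z by (metis antipode_antipode)
    have antipode_apply: "antipode x i = - x i" for i by (simp add: antipode_def)
    have "S (antipode x) = S x" by (simp add: S_def antipode_def)
    then show "f (antipode x) y = VR_antipode (f x) y"
      using antipode_apply by (simp add: f_def VR_antipode_def * add.commute cong: if_cong)
  qed
  ultimately have "odd_map n (VR_sphere m r) VR_antipode f"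
    by (simp add: odd_map_def VR_sphere_def K_def)
  then have "enat n \<le> coind (VR_sphere m r) VR_antipode"
    unfolding coind_def by (intro Sup_upper) blast
  moreover have "0 \<le> r" using c by (simp add: r_def arccos_lbound)
  ultimately show ?thesis
    unfolding c_threshold_def r_def[symmetric] by (intro cInf_lower bdd_belowI[of _ 0]) auto
qed

text \<open>The vector \<open>v\<^sub>k\<close> is the normalised incidence vector of the line \<open>y = a x + b\<close> over \<open>0 \<le> x < q\<close>, where the slope
  \<open>a < A\<close> and the intercept \<open>b < B\<close> are the quotient and remainder of \<open>k\<close> by \<open>B\<close>, and the grid point
  \<open>(x, y)\<close> is numbered \<open>q y + x\<close>.  Each line has \<open>q\<close> points and two lines share at most one.\<close>

lemma almost_orthogonal_lines:
  fixes q A B m :: nat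
  assumes q: "0 < q" and m: "q * (A * q + B) \<le> Suc m"
  obtains v :: "nat \<Rightarrow> nat \<Rightarrow> real" where
    "\<And>k. k < A * B \<Longrightarrow> v k \<in> topspace (nsphere m)"
    "\<And>k l. k < A * B \<Longrightarrow> l < A * B \<Longrightarrow> k \<noteq> l \<Longrightarrow> \<bar>dot {..m} (v k) (v l)\<bar> \<le> 1 / real q"
proof
  define line where "line = (\<lambda>k x. k div B * x + k mod B)"
  define v where "v = (\<lambda>k i. if i div q = line k (i mod q) then 1 / sqrt (real q) else 0)"
  have line_bound: "q * line k x + x \<le> m" if "k < A * B" "x < q" for k x
  proof -
    have B: "0 < B" using that(1) by (cases B) auto
    have "k div B < A" "k mod B < B" using that B by (auto simp: less_mult_imp_div_less)
    then have "k div B * x \<le> A * q" "k mod B + 1 \<le> B" using that by (auto intro: mult_le_mono)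
    then have "line k x + 1 \<le> A * q + B" unfolding line_def by linarith
    then have "q * (line k x + 1) \<le> q * (A * q + B)" by (rule mult_le_mono2)
    then show ?thesis using m that by (simp add: algebra_simps)
  qed
  have dot_v: "dot {..m} (v k) z = (\<Sum>x<q. z (q * line k x + x) / sqrt (real q))" if k: "k < A * B" for k z
  proof -
    have "(\<Sum>x<q. z (q * line k x + x) / sqrt (real q))
        = (\<Sum>i\<in>(\<lambda>x. q * line k x + x) ` {..<q}. v k i * z i)"
    proof (subst sum.reindex)
      show "inj_on (\<lambda>x. q * line k x + x) {..<q}"
        by (rule inj_on_inverseI[of _ "\<lambda>i. i mod q"]) simp
    qed (simp add: v_def)
    also have "\<dots> = (\<Sum>i\<le>m. v k i * z i)"
    proof (rule sum.mono_neutral_left)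
      show "\<forall>i\<in>{..m} - (\<lambda>x. q * line k x + x) ` {..<q}. v k i * z i = 0"
      proof
        fix i assume i: "i \<in> {..m} - (\<lambda>x. q * line k x + x) ` {..<q}"
        have "i div q \<noteq> line k (i mod q)"
        proof
          assume "i div q = line k (i mod q)"
          then have "i = q * line k (i mod q) + i mod q" by (metis mult_div_mod_eq)
          moreover have "i mod q < q" using q by simp
          ultimately show False using i by blast
        qed
        then show "v k i * z i = 0" by (simp add: v_def)
      qed
    qed (use line_bound[OF k] in auto)
    finally show ?thesis by (simp add: dot_def)
  qed
  have dot_vv: "dot {..m} (v k) (v l) = real (card {x. x < q \<and> line k x = line l x}) / real q"
    if "k < A * B" for k l
  proof -
    have "dot {..m} (v k) (v l) = (\<Sum>x<q. if line k x = line l x then 1 / real q else 0)"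
      unfolding dot_v[OF that] using q by (intro sum.cong) (auto simp: v_def)
    also have "\<dots> = (\<Sum>x\<in>{x \<in> {..<q}. line k x = line l x}. 1 / real q)"
      by (rule sum.inter_filter[symmetric]) simp
    finally show ?thesis by simp
  qed
  show "v k \<in> topspace (nsphere m)" if k: "k < A * B" for k
  proof -
    have "v k i = 0" if "m < i" for i
    proof (rule ccontr)
      assume "v k i \<noteq> 0"
      then have "i div q = line k (i mod q)" by (auto simp: v_def split: if_splits)
      then have "i = q * line k (i mod q) + i mod q" by (metis mult_div_mod_eq)
      with line_bound[OF k, of "i mod q"] q that show False by simp
    qed
    then show ?thesis using dot_vv[OF k, of k] q by (simp add: topspace_nsphere_iff)
  qed
  show "\<bar>dot {..m} (v k) (v l)\<bar> \<le> 1 / real q" if k: "k < A * B" and kl: "k \<noteq> l" for k l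
  proof -
    have "x = y" if x: "line k x = line l x" and y: "line k y = line l y" for x y
    proof (rule ccontr)
      assume "x \<noteq> y"
      have "int (k div B) * int x + int (k mod B) = int (l div B) * int x + int (l mod B)"
        "int (k div B) * int y + int (k mod B) = int (l div B) * int y + int (l mod B)"
        using x y by (simp_all add: line_def flip: of_nat_mult of_nat_add)
      then have "(int (k div B) - int (l div B)) * (int x - int y) = 0" by (simp add: algebra_simps)
      with \<open>x \<noteq> y\<close> have "k div B = l div B" by simp
      moreover from this have "k mod B = l mod B" using x by (simp add: line_def)
      ultimately have "k = l" by (metis div_mult_mod_eq)
      with kl show False by simp
    qed
    then have "card {x. x < q \<and> line k x = line l x} \<le> 1"
      by (auto simp: card_le_Suc0_iff_eq)
    then show ?thesis using dot_vv[OF k, of l] by (simp add: divide_right_mono)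
  qed
qed

text \<open>For fixed \<open>q\<close> and \<open>A\<close>, lines in a grid of \<open>m + 1\<close> points number about \<open>(A / q) m\<close>, so a large \<open>A\<close>
  reaches \<open>n + 1\<close>.\<close>

lemma eventually_c_threshold_le:
  fixes m n :: "nat \<Rightarrow> nat"
  assumes m_lim: "filterlim m at_top sequentially"
    and ratio_lim: "(\<lambda>j. real (n j) / real (m j)) \<longlonglongrightarrow> l"
    and e: "0 < e"
  shows "\<forall>\<^sub>F j in sequentially. c_threshold (m j) (n j) \<le> pi / 2 + e"
proof -
  have "isCont arccos 0" by (intro isCont_arccos) auto
  then have "(\<lambda>q. arccos (- (1 / real (Suc q)))) \<longlonglongrightarrow> arccos 0"
    by (rule isCont_tendsto_compose) (use LIMSEQ_Suc[OF lim_inverse_n] in \<open>auto simp: inverse_eq_divide intro: tendsto_eq_intros\<close>)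
  then have "\<forall>\<^sub>F q in sequentially. arccos (- (1 / real (Suc q))) < pi / 2 + e"
    using e by (intro order_tendstoD) auto
  then obtain q' where "arccos (- (1 / real (Suc q'))) < pi / 2 + e"
    by (auto simp: eventually_sequentially simp del: of_nat_Suc)
  then obtain q where q: "0 < q" "arccos (- (1 / real q)) < pi / 2 + e" by blast
  obtain L where L: "l + 1 < real L" using reals_Archimedean2 by blast
  (* The factor 2 pays for the part of the grid that the slopes take up, which is at most half of it. *)
  define A where "A = 2 * q * (L + 1)"
  have "\<forall>\<^sub>F j in sequentially. real (n j) / real (m j) < real L"
    using order_tendstoD(2)[OF ratio_lim, of "real L"] L by simp
  moreover have "\<forall>\<^sub>F j in sequentially. 2 * q * (2 + A * q) \<le> m j"
    using m_lim by (simp add: filterlim_at_top)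
  ultimately show ?thesis
  proof eventually_elim
    case (elim j)
    define D where "D = Suc (m j) div q"
    define B where "B = D - A * q"
    have D: "q * D \<le> Suc (m j)" "Suc (m j) < q * D + q"
      using mult_div_mod_eq[of q "Suc (m j)"] mod_less_divisor[OF q(1), of "Suc (m j)"]
      unfolding D_def by linarith+
    have m: "2 * q + 2 * (q * (A * q)) \<le> m j" using elim(2) by (simp add: algebra_simps)
    have "q * (A * q) < q * D" using D(2) m by linarith
    then have AD: "A * q \<le> D" by simp
    have "q * (A * q + B) \<le> Suc (m j)" using D(1) AD by (simp add: B_def)
    then obtain v :: "nat \<Rightarrow> nat \<Rightarrow> real" where v:
      "\<And>k. k < A * B \<Longrightarrow> v k \<in> topspace (nsphere (m j))"
      "\<And>k l. k < A * B \<Longrightarrow> l < A * B \<Longrightarrow> k \<noteq> l \<Longrightarrow> \<bar>dot {..m j} (v k) (v l)\<bar> \<le> 1 / real q"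
      by (rule almost_orthogonal_lines[OF q(1)]) blast
    have "q * D = q * (A * q) + q * B" using AD by (simp add: B_def flip: distrib_left)
    then have "m j + 2 \<le> 2 * (q * B)" using D(2) m by linarith
    then have "(L + 1) * (m j + 2) \<le> (L + 1) * (2 * (q * B))" by (rule mult_le_mono2)
    then have AB: "(L + 1) * (m j + 2) \<le> A * B" by (simp add: A_def mult_ac)
    have "0 < m j" using m q(1) by linarith
    then have "real (n j) < real L * real (m j)" using elim(1) by (simp add: field_simps)
    then have "n j < L * m j" by (simp flip: of_nat_mult)
    also have "\<dots> \<le> (L + 1) * (m j + 2)" by simp
    finally have "n j < A * B" using AB by linarith
    then have "c_threshold (m j) (n j) \<le> arccos (- (1 / real q))"
      using v q(1) by (intro c_threshold_le_of_almost_orthogonal[of _ v]) auto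
    with q(2) show ?case by simp
  qed
qed

section \<open>Asymptotics of the distance and of the gap\<close>

text \<open>Distances on spheres are at most \<open>\<pi>\<close>, so the real supremum that defines the distortion bounds each of
  its terms.\<close>

lemma GH_sphere_less_imp_correspondence:
  assumes "GH_sphere m n < \<eta>"
  obtains R d where "correspondence (topspace (nsphere m)) (topspace (nsphere n)) R" "d < 2 * \<eta>"
    "\<And>q p q' p'. (q, p) \<in> R \<Longrightarrow> (q', p') \<in> R \<Longrightarrow> \<bar>sphere_dist m q q' - sphere_dist n p p'\<bar> \<le> d"
proof -
  let ?A = "topspace (nsphere m)" and ?B = "topspace (nsphere n)"
  let ?D = "{distortion (sphere_dist m) (sphere_dist n) R | R. correspondence ?A ?B R}"
  have "correspondence ?A ?B (?A \<times> ?B)"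
    using in_topspace_nsphere[of m] in_topspace_nsphere[of n] by (auto simp: correspondence_def)
  then have "?D \<noteq> {}" by blast
  moreover have "Inf ?D < 2 * \<eta>" using assms by (simp add: GH_sphere_def gromov_hausdorff_def)
  ultimately obtain R where R: "correspondence ?A ?B R" "distortion (sphere_dist m) (sphere_dist n) R < 2 * \<eta>"
    using cInf_lessD[of ?D "2 * \<eta>"] by blast
  show thesis
  proof (rule that[OF R])
    fix q p q' p' assume R': "(q, p) \<in> R" "(q', p') \<in> R"
    show "\<bar>sphere_dist m q q' - sphere_dist n p p'\<bar> \<le> distortion (sphere_dist m) (sphere_dist n) R"
      unfolding distortion_def
    proof (rule cSup_upper)
      show "\<bar>sphere_dist m q q' - sphere_dist n p p'\<bar>
          \<in> {\<bar>sphere_dist m a a' - sphere_dist n b b'\<bar> |a a' b b'. (a, b) \<in> R \<and> (a', b') \<in> R}"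
        using R' by blast
      have "\<bar>sphere_dist m a a' - sphere_dist n b b'\<bar> \<le> pi" if "(a, b) \<in> R" "(a', b') \<in> R" for a a' b b'
      proof -
        have "a \<in> ?A" "a' \<in> ?A" "b \<in> ?B" "b' \<in> ?B" using that R(1) by (auto simp: correspondence_def)
        then show ?thesis
          using sphere_dist_bounds(1,2)[of a m a'] sphere_dist_bounds(1,2)[of b n b'] by linarith
      qed
      then show "bdd_above {\<bar>sphere_dist m a a' - sphere_dist n b b'\<bar> |a a' b b'. (a, b) \<in> R \<and> (a', b') \<in> R}"
        by (intro bdd_aboveI[of _ pi]) auto
    qed
  qed
qed

text \<open>If the distance were below \<open>\<eta>\<close>, the volume bound would give \<open>a\<^sup>m\<^sup>+\<^sup>1 / 4 \<le> b\<^sup>m\<close> with \<open>a\<close> slightly less than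
  \<open>sin (x - \<eta>)\<close> and \<open>b\<close> slightly more than \<open>(sin x)\<^sup>l\<close>.  As \<open>b < a\<close>, this fails for large \<open>m\<close>.\<close>

lemma eventually_GH_sphere_ge:
  fixes m n :: "nat \<Rightarrow> nat"
  assumes m_lim: "filterlim m at_top sequentially"
    and ratio_lim: "(\<lambda>j. real (n j) / real (m j)) \<longlonglongrightarrow> l" and l: "0 < l"
    and x: "x < pi / 2" "1 / 2 \<le> sin x" "0 < x"
    and \<eta>: "0 \<le> \<eta>" "\<eta> < x - arcsin (sin x powr l)"
  shows "\<forall>\<^sub>F j in sequentially. \<eta> \<le> GH_sphere (m j) (n j)"
proof -
  have sx: "0 < sin x" "sin x < 1" using x sin_monotone_2pi[of x "pi / 2"] by auto
  define \<theta> where "\<theta> = x - \<eta>"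
  define s where "s = sin \<theta>"
  have pw: "0 < sin x powr l" "sin x powr l \<le> 1" using sx l by (auto intro!: powr_le1)
  then have "0 < arcsin (sin x powr l)" using arcsin_less_arcsin[of 0 "sin x powr l"] by simp
  then have \<theta>: "0 < \<theta>" "\<theta> < pi / 2" "arcsin (sin x powr l) < \<theta>" using \<eta> x by (auto simp: \<theta>_def)
  have s: "sin x powr l < s" "0 < s"
  proof -
    have "sin (arcsin (sin x powr l)) < sin \<theta>"
      using \<theta> \<open>0 < arcsin (sin x powr l)\<close> by (intro sin_monotone_2pi) auto
    then show "sin x powr l < s" using pw by (simp add: s_def)
    with pw show "0 < s" by linarith
  qed
  have c: "0 < cos \<theta>" using \<theta> by (intro cos_gt_zero) auto
  have "((\<lambda>t. sin x powr t) \<longlongrightarrow> sin x powr l) (at_left l)"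
    using sx by (intro tendsto_intros) auto
  then have "\<forall>\<^sub>F t in at_left l. sin x powr t < s" using s(1) by (rule order_tendstoD)
  moreover have "\<forall>\<^sub>F t in at_left l. t < l" by (simp add: eventually_at_filter)
  ultimately have "\<exists>t. sin x powr t < s \<and> t < l"
    by (intro eventually_happens'[of "at_left l"] eventually_conj) auto
  then obtain l' where l': "sin x powr l' < s" "l' < l" by blast
  define b where "b = sin x powr l'"
  have b: "0 < b" "b < s" using sx l' by (auto simp: b_def)
  have "((\<lambda>e. s / sqrt (1 + 2 * e)) \<longlongrightarrow> s / sqrt (1 + 2 * 0)) (at_right 0)"
    by (intro tendsto_intros) auto
  then have ev_a: "\<forall>\<^sub>F e in at_right 0. b < s / sqrt (1 + 2 * e)" using b(2) by (intro order_tendstoD) auto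
  have ev_s: "\<forall>\<^sub>F e in at_right 0. 0 < e \<and> e < s"
    using eventually_at_right_real[OF s(2)] by (auto elim: eventually_mono)
  have "\<exists>e. b < s / sqrt (1 + 2 * e) \<and> (0 < e \<and> e < s)"
    by (rule eventually_happens'[OF _ eventually_conj[OF ev_a ev_s]]) simp
  then obtain e where e: "b < s / sqrt (1 + 2 * e)" "0 < e" "e < s" by blast
  define a where "a = s / sqrt (1 + 2 * e)"
  define t where "t = sqrt (s\<^sup>2 - e\<^sup>2) / s"
  have es: "0 < s\<^sup>2 - e\<^sup>2" "s\<^sup>2 - e\<^sup>2 < s\<^sup>2" using e power_strict_mono[of e s 2] by auto
  have t: "0 \<le> t" "t < 1"
    using es s(2) real_sqrt_less_mono[OF es(2)] by (auto simp: t_def)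
  have a: "0 < a" "0 \<le> b / a" "b / a < 1" using e b s by (auto simp: a_def field_simps)
  have "(\<lambda>k. t ^ Suc k) \<longlonglongrightarrow> 0" using t by (intro LIMSEQ_Suc LIMSEQ_realpow_zero)
  from order_tendstoD(2)[OF filterlim_compose[OF this m_lim], of "1 / 4"]
  have ev1: "\<forall>\<^sub>F j in sequentially. t ^ Suc (m j) < 1 / 4" by simp
  have "(\<lambda>k. (b / a) ^ k) \<longlonglongrightarrow> 0" using a by (intro LIMSEQ_realpow_zero)
  from order_tendstoD(2)[OF filterlim_compose[OF this m_lim], of "a / 4"] a
  have ev2: "\<forall>\<^sub>F j in sequentially. (b / a) ^ m j < a / 4" by simp
  have ev3: "\<forall>\<^sub>F j in sequentially. l' < real (n j) / real (m j)"
    using order_tendstoD(1)[OF ratio_lim l'(2)] .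
  have ev4: "\<forall>\<^sub>F j in sequentially. 1 \<le> m j" using m_lim by (simp add: filterlim_at_top)
  show ?thesis
    using ev1 ev2 ev3 ev4
  proof eventually_elim
    case (elim j)
    let ?N = "Suc (m j)"
    show ?case
    proof (rule ccontr)
      assume "\<not> \<eta> \<le> GH_sphere (m j) (n j)"
      then have "GH_sphere (m j) (n j) < \<eta>" by simp
      then obtain R d where R: "correspondence (topspace (nsphere (m j))) (topspace (nsphere (n j))) R" "d < 2 * \<eta>"
        "\<And>q p q' p'. (q, p) \<in> R \<Longrightarrow> (q', p') \<in> R \<Longrightarrow> \<bar>sphere_dist (m j) q q' - sphere_dist (n j) p p'\<bar> \<le> d"
        by (rule GH_sphere_less_imp_correspondence) blast
      define \<kappa> where "\<kappa> = (1 / sqrt (1 + 2 * e)) ^ ?N * (s ^ ?N / 2 - sqrt (s\<^sup>2 - e\<^sup>2) ^ ?N)"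
      have "\<kappa> \<le> sin x ^ Suc (n j)"
      proof (rule cap_volume_bound_of_correspondence[OF R(1) R(3) \<theta>(1,2)])
        show "2 * \<theta> + d < 2 * x" using R(2) by (simp add: \<theta>_def)
        fix q assume "q \<in> topspace (nsphere (m j))"
        then have "dot {..m j} q q = 1" by (simp add: topspace_nsphere_iff)
        then show "\<kappa> * measure (lebesgue_on_coords {..m j}) (coord_ball {..m j} 1)
          \<le> measure (lebesgue_on_coords {..m j})
             {z \<in> coord_ball {..m j} 1. cos \<theta> * sqrt (dot {..m j} z z) < dot {..m j} q z}"
          using cone_volume_lower_bound[of "{..m j}" q s "cos \<theta>" e] s c e by (simp add: \<kappa>_def s_def)
      qed (use x in auto)
      also have "\<dots> \<le> sin x ^ n j" using sx by (simp add: mult_left_le_one_le)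
      also have "\<dots> = sin x powr real (n j)" using sx by (simp add: powr_realpow)
      also have "\<dots> \<le> sin x powr (l' * real (m j))"
        using elim(3,4) sx by (intro powr_mono') (auto simp: field_simps)
      also have "\<dots> = b ^ m j" using sx by (simp add: b_def powr_powr[symmetric] powr_realpow)
      also have "\<dots> < a ^ ?N / 4" using elim(2) a(1) by (simp add: power_divide field_simps)
      finally have "\<kappa> < a ^ ?N / 4" .
      moreover have "a ^ ?N / 4 \<le> \<kappa>"
      proof -
        have "sqrt (s\<^sup>2 - e\<^sup>2) ^ ?N = s ^ ?N * t ^ ?N"
          using s(2) by (simp add: t_def flip: power_mult_distrib)
        also have "\<dots> \<le> s ^ ?N * (1 / 4)" using elim(1) s(2) by (intro mult_left_mono) auto
        finally have "s ^ ?N / 4 \<le> s ^ ?N / 2 - sqrt (s\<^sup>2 - e\<^sup>2) ^ ?N" by simp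
        then have "(1 / sqrt (1 + 2 * e)) ^ ?N * (s ^ ?N / 4) \<le> \<kappa>"
          unfolding \<kappa>_def using e by (intro mult_left_mono) auto
        then show ?thesis by (simp add: a_def power_divide)
      qed
      ultimately show False by simp
    qed
  qed
qed

lemma liminf_gap_ge:
  fixes m n :: "nat \<Rightarrow> nat"
  assumes m_lim: "filterlim m at_top sequentially"
    and ratio_lim: "(\<lambda>j. real (n j) / real (m j)) \<longlonglongrightarrow> l" and l: "0 < l"
    and x: "x < pi / 2" "1 / 2 \<le> sin x" "0 < x" and pos: "0 < x - arcsin (sin x powr l)"
  shows "ereal (x - arcsin (sin x powr l) - pi / 4)
    \<le> liminf (\<lambda>j. ereal (GH_sphere (m j) (n j) - c_threshold (m j) (n j) / 2))"
  unfolding le_Liminf_iff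
proof (intro allI impI)
  fix y assume "y < ereal (x - arcsin (sin x powr l) - pi / 4)"
  then obtain w where w: "y < ereal w" "w < x - arcsin (sin x powr l) - pi / 4"
    by (metis ereal_dense2 ereal_less_ereal_Ex less_ereal.simps(1))
  define v where "v = x - arcsin (sin x powr l)"
  define \<delta> where "\<delta> = v - pi / 4 - w"
  have \<delta>: "0 < \<delta>" using w by (simp add: \<delta>_def v_def)
  have "\<forall>\<^sub>F j in sequentially. max 0 (v - \<delta> / 2) \<le> GH_sphere (m j) (n j)"
    using \<delta> pos by (intro eventually_GH_sphere_ge[OF m_lim ratio_lim l x]) (auto simp: v_def)
  moreover have "\<forall>\<^sub>F j in sequentially. c_threshold (m j) (n j) \<le> pi / 2 + \<delta>"
    by (rule eventually_c_threshold_le[OF m_lim ratio_lim \<delta>])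
  ultimately show "\<forall>\<^sub>F j in sequentially. y < ereal (GH_sphere (m j) (n j) - c_threshold (m j) (n j) / 2)"
  proof eventually_elim
    case (elim j)
    then have "v - \<delta> / 2 \<le> GH_sphere (m j) (n j)" by simp
    then have "w \<le> GH_sphere (m j) (n j) - c_threshold (m j) (n j) / 2"
      using elim(2) \<delta>_def by linarith
    with w(1) show ?case by (meson ereal_less_eq(3) less_le_trans)
  qed
qed

section \<open>The critical ratio\<close>

text \<open>The quotient tends to infinity at both ends: at \<open>\<pi>/4\<close> because the numerator does so in absolute value, and
  at \<open>\<pi>/2\<close> because the denominator vanishes.  The points \<open>\<pi>/4 + p\<close> and \<open>p'\<close> are explicit
  cut-offs beyond which it exceeds its value at \<open>3 \<pi> / 8\<close>.\<close>

lemma ratio_star_attains_min: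
  "\<exists>x\<in>{pi/4<..<pi/2}. ratio_star x = lambda_star \<and> (\<forall>y\<in>{pi/4<..<pi/2}. ratio_star x \<le> ratio_star y)"
proof -
  define \<sigma> where "\<sigma> = sin (pi / 4 :: real)"
  have \<sigma>: "0 < \<sigma>" "\<sigma> < 1" using sin_gt_zero[of "pi/4"] sin_monotone_2pi[of "pi/4" "pi/2"] by (auto simp: \<sigma>_def)
  have bounds: "0 < sin (x - pi/4) \<and> sin (x - pi/4) < \<sigma> \<and> \<sigma> < sin x \<and> sin x < 1" if "x \<in> {pi/4<..<pi/2}" for x
    using that sin_gt_zero[of "x - pi/4"] sin_monotone_2pi[of "x - pi/4" "pi/4"] sin_monotone_2pi[of "pi/4" x]
      sin_monotone_2pi[of x "pi/2"] by (auto simp: \<sigma>_def)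
  have logs: "ln (sin (x - pi/4)) < ln \<sigma>" "ln \<sigma> < ln (sin x)" "ln (sin x) < 0" "ln \<sigma> < 0" if "x \<in> {pi/4<..<pi/2}" for x
    using bounds[OF that] \<sigma> by auto
  define x0 where "x0 = 3 * pi / 8"
  have x0: "x0 \<in> {pi/4<..<pi/2}" using pi_gt_zero by (auto simp: x0_def)
  define M where "M = ratio_star x0"
  have M: "0 < M" using logs[OF x0] by (auto simp: M_def ratio_star_def intro!: divide_neg_neg)
  define p where "p = \<sigma> powr M"
  define p' where "p' = arcsin (\<sigma> powr (1 / M))"
  have p: "0 < p" using \<sigma> by (simp add: p_def)
  have "\<sigma> powr (1 / M) < 1" using \<sigma> M powr_less_mono2[of "1 / M" \<sigma> 1] by simp
  then have "p' < arcsin 1" unfolding p'_def using \<sigma> by (intro arcsin_less_arcsin) (auto intro: order_trans[of _ 0])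
  then have p': "p' < pi / 2" by simp
  have left: "M < ratio_star x" if x: "x \<in> {pi/4<..<pi/2}" "x < pi / 4 + p" for x
  proof -
    have "sin (x - pi/4) \<le> x - pi/4" using x by (intro sin_x_le_x) auto
    then have "sin (x - pi/4) < \<sigma> powr M" using x by (simp add: p_def)
    then have "ln (sin (x - pi/4)) < M * ln \<sigma>"
      using bounds[OF x(1)] \<sigma> by (metis ln_less_cancel_iff ln_powr powr_gt_zero less_irrefl)
    also have "\<dots> < M * ln (sin x)" using logs[OF x(1)] M by simp
    finally show ?thesis using logs[OF x(1)] by (simp add: ratio_star_def neg_less_divide_eq)
  qed
  have right: "M < ratio_star x" if x: "x \<in> {pi/4<..<pi/2}" "p' < x" for x
  proof -
    have "-1 \<le> \<sigma> powr (1 / M)" by (rule order_trans[OF _ powr_ge_zero]) simp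
    then have "- (pi / 2) \<le> p'" "sin p' = \<sigma> powr (1 / M)"
      using \<open>\<sigma> powr (1 / M) < 1\<close> by (auto simp: p'_def intro!: arcsin_lbound sin_arcsin)
    moreover have "sin p' < sin x" using x calculation by (intro sin_monotone_2pi) auto
    ultimately have "\<sigma> powr (1 / M) < sin x" by simp
    then have "ln (\<sigma> powr (1 / M)) < ln (sin x)"
      using bounds[OF x(1)] \<sigma> by (subst ln_less_cancel_iff) auto
    then have "ln \<sigma> < M * ln (sin x)" using M \<sigma> by (simp add: ln_powr field_simps)
    then have "ln (sin (x - pi/4)) < M * ln (sin x)" using logs[OF x(1)] by linarith
    then show ?thesis using logs[OF x(1)] by (simp add: ratio_star_def neg_less_divide_eq)
  qed
  define K where "K = {min x0 (pi / 4 + p)..max x0 p'}"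
  have K: "K \<subseteq> {pi/4<..<pi/2}" "x0 \<in> K" using x0 p p' by (auto simp: K_def)
  have "continuous_on K ratio_star"
    unfolding ratio_star_def using K(1) bounds logs
    by (intro continuous_intros) (auto simp: less_imp_neq less_imp_neq[symmetric] subset_iff, force+)
  then obtain x where x: "x \<in> K" "\<And>y. y \<in> K \<Longrightarrow> ratio_star x \<le> ratio_star y"
    using continuous_attains_inf[of K ratio_star] K(2) by (metis K_def compact_Icc empty_iff)
  have min: "ratio_star x \<le> ratio_star y" if y: "y \<in> {pi/4<..<pi/2}" for y
  proof (cases "y \<in> K")
    case False
    then have "y < pi / 4 + p \<or> p' < y" by (auto simp: K_def)
    then have "M < ratio_star y" using left right y by blast
    moreover have "ratio_star x \<le> M" using x(2) K(2) by (simp add: M_def)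
    ultimately show ?thesis by simp
  qed (use x in auto)
  have "lambda_star = ratio_star x"
    unfolding lambda_star_def using min x(1) K(1) by (intro cInf_eq_minimum) auto
  then show ?thesis using min x(1) K(1) by force
qed

lemma ratio_star_less_iff:
  assumes x: "x \<in> {pi/4<..<pi/2}" and l: "0 < l"
  shows "pi / 4 < x - arcsin (sin x powr l) \<longleftrightarrow> ratio_star x < l"
proof -
  have s: "0 < sin x" "sin x < 1" "0 < sin (x - pi/4)"
    using x sin_gt_zero[of x] sin_gt_zero[of "x - pi/4"] sin_monotone_2pi[of x "pi/2"] by auto
  have pw: "0 < sin x powr l" "sin x powr l \<le> 1" using s l by (auto intro!: powr_le1)
  have "pi / 4 < x - arcsin (sin x powr l) \<longleftrightarrow> arcsin (sin x powr l) < arcsin (sin (x - pi/4))"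
    using x by (subst arcsin_sin) auto
  also have "\<dots> \<longleftrightarrow> sin x powr l < sin (x - pi/4)"
    using pw s by (intro arcsin_less_mono) auto
  also have "\<dots> \<longleftrightarrow> ln (sin x powr l) < ln (sin (x - pi/4))"
    by (rule ln_less_cancel_iff[symmetric]) (use pw s in auto)
  also have "\<dots> \<longleftrightarrow> l * ln (sin x) < ln (sin (x - pi/4))" using s by (simp add: ln_powr)
  also have "\<dots> \<longleftrightarrow> ratio_star x < l"
    using s by (simp add: ratio_star_def neg_divide_less_eq)
  finally show ?thesis .
qed

lemma Phi_chi_gt_iff:
  assumes l: "1 < l"
  shows "pi / 4 < Phi_chi l \<longleftrightarrow> lambda_star < l"
proof
  assume Phi: "pi / 4 < Phi_chi l"
  obtain x where x: "x \<in> {0<..<pi/2}" "Phi_chi l = x - arcsin (sin x powr l)"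
    using Phi_chi_attained[OF l] by blast
  have s: "0 \<le> sin x" using x by (intro sin_ge_zero) auto
  have "sin x powr l \<le> 1" using s l by (intro powr_le1) auto
  then have "0 \<le> arcsin (sin x powr l)" using arcsin_le_arcsin[of 0 "sin x powr l"] by simp
  then have x': "x \<in> {pi/4<..<pi/2}" using x Phi by auto
  then have "ratio_star x < l" using ratio_star_less_iff[of x l] l Phi x(2) by simp
  then show "lambda_star < l" using ratio_star_attains_min x' by (metis le_less_trans)
next
  assume l': "lambda_star < l"
  obtain x where x: "x \<in> {pi/4<..<pi/2}" "ratio_star x = lambda_star" using ratio_star_attains_min by blast
  then have "pi / 4 < x - arcsin (sin x powr l)" using ratio_star_less_iff[of x l] l l' by simp
  also have "\<dots> \<le> Phi_chi l"
  proof -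
    have "x \<in> {0<..<pi/2}" using x pi_gt_zero by auto
    then show ?thesis using Phi_chi_attained[OF l] by metis
  qed
  finally show "pi / 4 < Phi_chi l" .
qed

section \<open>The explicit bound from the golden ratio\<close>

text \<open>The angle \<open>t = \<pi>/10\<close> satisfies \<open>sin (2 t) = cos (3 t)\<close>, which is quadratic in \<open>sin t\<close> after
  division by \<open>cos t\<close>.\<close>

lemma sin_pi_tenth: "sin (pi / 10) = (sqrt 5 - 1) / 4"
proof -
  define s where "s = sin (pi / 10)"
  have s: "0 < s" unfolding s_def using pi_gt_zero by (intro sin_gt_zero) (auto simp: field_simps)
  have c: "0 < cos (pi / 10)" using pi_gt_zero by (intro cos_gt_zero) (auto simp: field_simps)
  have "sin (2 * (pi / 10)) = cos (3 * (pi / 10))"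
    by (subst sin_cos_eq) (simp add: field_simps)
  then have "2 * s * cos (pi / 10) = 4 * cos (pi / 10) ^ 3 - 3 * cos (pi / 10)"
    unfolding cos_treble_cos sin_double s_def by simp
  then have "cos (pi / 10) * (2 * s) = cos (pi / 10) * (4 * (cos (pi / 10))\<^sup>2 - 3)"
    by (simp add: power2_eq_square power3_eq_cube algebra_simps)
  then have "2 * s = 4 * (1 - s\<^sup>2) - 3" using c by (simp add: cos_squared_eq s_def)
  then have "(4 * s + 1)\<^sup>2 = 5" by (simp add: power2_eq_square algebra_simps)
  then have "4 * s + 1 = sqrt 5" using s by (intro real_sqrt_unique[symmetric]) auto
  then show ?thesis by (simp add: s_def)
qed

lemma sin_three_pi_tenths: "sin (3 * pi / 10) = (1 + sqrt 5) / 4"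
proof -
  have "sin (3 * pi / 10) = cos (2 * (pi / 10))"
    by (subst sin_cos_eq) (simp add: field_simps)
  also have "\<dots> = 1 - 2 * (sin (pi / 10))\<^sup>2" by (rule cos_double_sin)
  also have "\<dots> = (1 + sqrt 5) / 4" by (simp add: sin_pi_tenth power2_eq_square field_simps)
  finally show ?thesis .
qed

lemma golden_ninth_power: "((1 + sqrt 5) / 4) ^ 9 = (38 + 17 * sqrt 5) / 512"
proof -
  have 3: "(1 + sqrt 5) ^ 3 = 16 + 8 * sqrt 5"
    by (simp add: power3_eq_cube algebra_simps)
  have "(1 + sqrt 5) ^ 9 = ((1 + sqrt 5) ^ 3) ^ 3" by (simp flip: power_mult)
  also have "\<dots> = 512 * (38 + 17 * sqrt 5)"
    unfolding 3 by (simp add: power3_eq_cube algebra_simps)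
  finally show ?thesis by (simp add: power_divide)
qed

lemma arcsin_golden_less: "arcsin ((38 + 17 * sqrt 5) / 512) < pi / 20"
proof -
  define t where "t = (38 + 17 * sqrt 5) / 512"
  have s5: "sqrt 5 < 2.237" "2.236 < sqrt 5"
    by (rule real_less_lsqrt real_less_rsqrt; simp add: power2_eq_square)+
  have t: "0 < t" "t < 0.1486" using s5 by (auto simp: t_def)
  have "0.309 < sin (pi / 10)" using s5 by (simp add: sin_pi_tenth)
  then have "0.309 * 0.309 < sin (pi / 10) * sin (pi / 10)" by (intro mult_strict_mono) auto
  then have "(cos (pi / 10))\<^sup>2 < 0.952\<^sup>2" 
    using sin_cos_squared_add[of "pi / 10"] by (simp add: power2_eq_square)
  then have "cos (pi / 10) < 0.952" by (rule power_less_imp_less_base) simp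
  then have "(sin (pi / 20))\<^sup>2 > 0.024" using cos_double_sin[of "pi / 20"] by simp
  moreover have "t * t < 0.1486 * 0.1486" using t by (intro mult_strict_mono) auto
  ultimately have "t\<^sup>2 < (sin (pi / 20))\<^sup>2" by (simp add: power2_eq_square)
  moreover have "0 \<le> sin (pi / 20)" using pi_gt_zero by (intro sin_ge_zero) (auto simp: field_simps)
  ultimately have "t < sin (pi / 20)" by (rule power_less_imp_less_base)
  then have "arcsin t < arcsin (sin (pi / 20))" using t by (intro arcsin_less_arcsin) auto
  also have "\<dots> = pi / 20" using pi_gt_zero by (intro arcsin_sin) (auto simp: field_simps)
  finally show ?thesis by (simp add: t_def)
qed

text \<open>Every \<open>x\<close> relevant to the gap exceeds \<open>\<pi>/4\<close>, so the lower bound on \<open>sin x\<close> in the volume estimate costs nothing.\<close>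

lemma half_le_sin:
  assumes "pi / 4 < x" "x < pi / 2"
  shows "1 / 2 \<le> sin x"
  using assms pi_gt_zero sin_monotone_2pi_le[of "pi / 6" x] by (simp add: sin_30)

theorem corollary8p13:
  fixes m n :: "nat \<Rightarrow> nat" and l :: real
  assumes mn: "\<And>j. 1 \<le> m j \<and> m j < n j"
    and m_lim: "filterlim m at_top sequentially"
    and ratio_lim: "(\<lambda>j. real (n j) / real (m j)) \<longlonglongrightarrow> l"
    and lambda: "1 < l"
  shows "(\<exists>x\<in>{pi/4<..<pi/2}. ratio_star x = lambda_star \<and>
            (\<forall>y\<in>{pi/4<..<pi/2}. ratio_star x \<le> ratio_star y)) \<and>
         (Phi_chi l > pi/4 \<longleftrightarrow> l > lambda_star) \<and>
         (l > lambda_star \<longrightarrow>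
            liminf (\<lambda>j. ereal (GH_sphere (m j) (n j) - c_threshold (m j) (n j) / 2)) > 0 \<and>
            (\<forall>\<^sub>F j in sequentially. c_threshold (m j) (n j) / 2 < GH_sphere (m j) (n j))) \<and>
         (l \<ge> 9 \<longrightarrow>
            liminf (\<lambda>j. ereal (GH_sphere (m j) (n j) - c_threshold (m j) (n j) / 2))
              \<ge> ereal (pi/20 - arcsin ((38 + 17 * sqrt 5) / 512)) \<and>
            pi/20 - arcsin ((38 + 17 * sqrt 5) / 512) > 0)"
proof (intro conjI impI)
  let ?gap = "\<lambda>j. ereal (GH_sphere (m j) (n j) - c_threshold (m j) (n j) / 2)"
  have l: "0 < l" using lambda by simp
  show "\<exists>x\<in>{pi/4<..<pi/2}. ratio_star x = lambda_star \<and> (\<forall>y\<in>{pi/4<..<pi/2}. ratio_star x \<le> ratio_star y)"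
    by (rule ratio_star_attains_min)
  show "Phi_chi l > pi/4 \<longleftrightarrow> l > lambda_star" by (rule Phi_chi_gt_iff[OF lambda])
  show pos: "liminf ?gap > 0" if ls: "l > lambda_star"
  proof -
    obtain x where x: "x \<in> {pi/4<..<pi/2}" "ratio_star x = lambda_star" using ratio_star_attains_min by blast
    then have gap: "pi / 4 < x - arcsin (sin x powr l)" using ratio_star_less_iff[of x l] l ls by simp
    have "ereal (x - arcsin (sin x powr l) - pi / 4) \<le> liminf ?gap"
      using x pi_gt_zero gap half_le_sin[of x] by (intro liminf_gap_ge[OF m_lim ratio_lim l]) auto
    moreover have "0 < ereal (x - arcsin (sin x powr l) - pi / 4)" using gap by simp
    ultimately show ?thesis by (rule less_le_trans[rotated])
  qed
  show "\<forall>\<^sub>F j in sequentially. c_threshold (m j) (n j) / 2 < GH_sphere (m j) (n j)" if "l > lambda_star"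
    using less_LiminfD[OF pos[OF that]] by (auto elim: eventually_mono)
  show "pi/20 - arcsin ((38 + 17 * sqrt 5) / 512) > 0" using arcsin_golden_less by simp
  show "liminf ?gap \<ge> ereal (pi/20 - arcsin ((38 + 17 * sqrt 5) / 512))" if "l \<ge> 9"
  proof -
    define x where "x = 3 * pi / 10"
    have x: "pi / 4 < x" "x < pi / 2" using pi_gt_zero by (auto simp: x_def)
    have s: "0 < sin x" "sin x \<le> 1" using half_le_sin[OF x] by auto
    have "sin x powr l \<le> sin x powr 9" using s that by (intro powr_mono') auto
    also have "\<dots> = sin x ^ 9" using s powr_realpow[of "sin x" 9] by simp
    also have "\<dots> = (38 + 17 * sqrt 5) / 512"
      unfolding x_def sin_three_pi_tenths by (rule golden_ninth_power)
    finally have le: "sin x powr l \<le> (38 + 17 * sqrt 5) / 512" .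
    have "sqrt 5 \<le> 3" by (rule real_le_lsqrt) auto
    then have "arcsin (sin x powr l) \<le> arcsin ((38 + 17 * sqrt 5) / 512)"
      using le s by (intro arcsin_le_arcsin) (auto intro: order_trans[of _ 0])
    then have "pi/20 - arcsin ((38 + 17 * sqrt 5) / 512) \<le> x - arcsin (sin x powr l) - pi / 4"
      by (simp add: x_def)
    moreover have "ereal (x - arcsin (sin x powr l) - pi / 4) \<le> liminf ?gap"
      using x pi_gt_zero half_le_sin[OF x] calculation arcsin_golden_less
      by (intro liminf_gap_ge[OF m_lim ratio_lim l]) auto
    ultimately show ?thesis by (meson ereal_less_eq(3) order_trans)
  qed
qed

end
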